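(* For any $\gamma\in S$, we have $\bar A_*(\gamma)=\bar A_\theta(\gamma)$, where $\theta=\langle-,\gamma\rangle$.
   Context: Setting. $S=\mathbb N^r\setminus\{0\}$, $\Gamma=\mathbb Z^r$, $S^*=\bigsqcup_{n\ge1}S^n$. $\mathcal R=\bigoplus_{\gamma\in\mathbb N^r}\mathcal R_\gamma$ is a graded associative (not necessarily commutative) $\mathbb Q$-algebra, and $\Gamma$ carries a skew-symmetric bilinear form $\langle-,-\rangle:\Gamma\times\Gamma\to\mathbb Z$ such that $\langle\gamma,\gamma'\rangle=0$ implies $[\mathcal R_\gamma,\mathcal R_{\gamma'}]=0$. Fix an arbitrary map $A:S\to\mathcal R$ with $A(\gamma)\in\mathcal R_\gamma$. Stability parameters. For $\theta\in\mathrm{Hom}(\mathbb Z^r,\mathbb R)\cong\mathbb R^r$ and $a\in S$ put $\mu_\theta(a)=\theta(a)/\sum_ka_k$; write $a>_\theta b$ if $\mu_\theta(a)>\mu_\theta(b)$ and $a\sim_\theta b$ if $\mu_\theta(a)=\mu_\theta(b)$. The parameter $\theta$ is generic if $a\sim_\theta b$ (for $a,b\in S$) implies that $a,b$ are proportional. Invariants. For any $\theta$ (generic or not), the family $A_\theta(\gamma)\in\mathcal R_\gamma$, $\gamma\in S$, is determined recursively by $$A(\gamma)=\sum_{\alpha_1+\dots+\alpha_n=\gamma,\ \alpha_1>_\theta\dots>_\theta\alpha_n}A_\theta(\alpha_1)\cdots A_\theta(\alpha_n),\qquad\gamma\in S,$$ and $$\bar A_\theta(\gamma)=\sum_{n\ge1}\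 \sum_{\alpha\in S^n,\ \alpha_1+\dots+\alpha_n=\gamma,\ \alpha_1\sim_\theta\dots\sim_\theta\alpha_n}\frac{(-1)^{n-1}}n\,A_\theta(\alpha_1)\cdots A_\theta(\alpha_n).$$ The attractor invariants are $\bar A_*(\gamma)=\bar A_{\theta'}(\gamma)$, where $\theta'$ is a generic perturbation of $\theta=\langle-,\gamma\rangle$, i.e. a generic stability parameter $\theta'\in\mathbb R^r$ sufficiently close to $\theta$ (how close depends on $\gamma$; the value does not depend on the choice). The parameter $\theta=\langle-,\gamma\rangle$ itself is in general not generic. *)

theory Defs
  imports "HOL-Analysis.Analysis"
begin

text \<open>
  The finite index type \<open>'r\<close> plays the role of \<open>{1..r}\<close>: \<open>nat ^ 'r\<close> is the monoid of degrees,
  \<open>int ^ 'r\<close> the lattice \<open>\<Gamma>\<close>, \<open>real ^ 'r\<close> the space of stability parameters, and \<open>S\<close> consists of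
  the nonzero elements of \<open>nat ^ 'r\<close>.
\<close>

section \<open>Graded algebras and skew-symmetric forms\<close>

text \<open>
  The sort \<open>{ring, monoid_mult}\<close> describes associative unital, not necessarily commutative rings;
  unlike \<open>ring_1\<close> it does not exclude the zero ring.
\<close>

locale graded_rat_algebra = vector_space smul
  for smul :: "rat \<Rightarrow> 'a::{ring, monoid_mult} \<Rightarrow> 'a" +
  fixes R :: "nat ^ 'r::finite \<Rightarrow> 'a set"
  assumes smul_mult_left: "smul q x * y = smul q (x * y)"
    and smul_mult_right: "x * smul q y = smul q (x * y)"
    and subspace_component: "module.subspace smul (R \<gamma>)"
    and direct_sum: "\<exists>!f. finite {\<gamma>. f \<gamma> \<noteq> 0} \<and> (\<forall>\<gamma>. f \<gamma> \<in> R \<gamma>) \<and> x = (\<Sum>\<gamma> | f \<gamma> \<noteq> 0. f \<gamma>)"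
    and mult_component: "x \<in> R \<gamma> \<Longrightarrow> y \<in> R \<delta> \<Longrightarrow> x * y \<in> R (\<gamma> + \<delta>)"

definition skew_bilinear :: "(int ^ 'r::finite \<Rightarrow> int ^ 'r \<Rightarrow> int) \<Rightarrow> bool" where
  "skew_bilinear form \<longleftrightarrow>
     (\<forall>x y z. form (x + y) z = form x z + form y z) \<and>
     (\<forall>x y z. form x (y + z) = form x y + form x z) \<and>
     (\<forall>x y. form x y = - form y x)"

definition int_vec :: "nat ^ 'r \<Rightarrow> int ^ 'r::finite" where
  "int_vec a = (\<chi> i. int (a $ i))"

section \<open>Stability parameters\<close>

definition slope :: "real ^ 'r \<Rightarrow> nat ^ 'r::finite \<Rightarrow> real" where
  "slope \<theta> a = (\<Sum>i\<in>UNIV. \<theta> $ i * real (a $ i)) / (\<Sum>i\<in>UNIV. real (a $ i))"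

definition proportional :: "nat ^ 'r \<Rightarrow> nat ^ 'r::finite \<Rightarrow> bool" where
  "proportional a b \<longleftrightarrow> (\<exists>c::real. \<forall>i. real (a $ i) = c * real (b $ i))"

definition generic :: "real ^ 'r::finite \<Rightarrow> bool" where
  "generic \<theta> \<longleftrightarrow> (\<forall>a b. a \<noteq> 0 \<and> b \<noteq> 0 \<and> slope \<theta> a = slope \<theta> b \<longrightarrow> proportional a b)"

text \<open>The parameter \<open>\<langle>-, \<gamma>\<rangle>\<close>, written in coordinates with respect to the standard basis of \<open>\<Gamma>\<close>.\<close>

definition attractor_stability ::
    "(int ^ 'r \<Rightarrow> int ^ 'r \<Rightarrow> int) \<Rightarrow> nat ^ 'r \<Rightarrow> real ^ 'r::finite" where
  "attractor_stability form \<gamma> = (\<chi> i. real_of_int (form (axis i 1) (int_vec \<gamma>)))"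

lemma attractor_stability_pairing:
  fixes form :: "int ^ 'r::finite \<Rightarrow> int ^ 'r \<Rightarrow> int"
  assumes "skew_bilinear form"
  shows "(\<Sum>i\<in>UNIV. attractor_stability form \<gamma> $ i * real (a $ i)) =
    real_of_int (form (int_vec a) (int_vec \<gamma>))"
proof -
  define f where "f = (\<lambda>x. form x (int_vec \<gamma>))"
  have add: "f (x + y) = f x + f y" for x y
    using assms unfolding f_def skew_bilinear_def by blast
  have zero: "f 0 = 0" using add[of 0 0] by simp
  have sum: "f (\<Sum>i\<in>I. g i) = (\<Sum>i\<in>I. f (g i))" if "finite I" for I :: "'r set" and g
    using that by (induction I) (simp_all add: zero add)
  have axis: "f (axis i (int n)) = f (axis i 1) * int n" for i n
  proof (induction n)
    case 0
    have "f (axis i 0) = f 0"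
      by (rule arg_cong[of _ _ f]) (simp add: axis_def vec_eq_iff)
    then show ?case by (simp add: zero)
  next
    case (Suc n)
    have "axis i (int (Suc n)) = axis i (int n) + axis i 1" by (simp add: axis_def vec_eq_iff)
    then show ?case using Suc by (simp add: add algebra_simps)
  qed
  have "int_vec a = (\<Sum>i\<in>UNIV. axis i (int (a $ i)))"
    by (simp add: int_vec_def vec_eq_iff axis_def)
  then have "f (int_vec a) = (\<Sum>i\<in>UNIV. f (axis i 1) * int (a $ i))"
    by (simp add: sum axis)
  then show ?thesis by (simp add: attractor_stability_def f_def)
qed

section \<open>Invariants\<close>

text \<open>
  Since comparison of slopes is transitive, imposing it on all pairs of entries by \<open>sorted_wrt\<close>
  is the same as imposing it on consecutive entries.
\<close>

definition decreasing_decomps :: "real ^ 'r \<Rightarrow> nat ^ 'r \<Rightarrow> (nat ^ 'r::finite) list set" where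
  "decreasing_decomps \<theta> \<gamma> =
     {\<alpha>s. \<alpha>s \<noteq> [] \<and> 0 \<notin> set \<alpha>s \<and> sum_list \<alpha>s = \<gamma> \<and>
          sorted_wrt (\<lambda>a b. slope \<theta> a > slope \<theta> b) \<alpha>s}"

definition equal_slope_decomps :: "real ^ 'r \<Rightarrow> nat ^ 'r \<Rightarrow> (nat ^ 'r::finite) list set" where
  "equal_slope_decomps \<theta> \<gamma> =
     {\<alpha>s. \<alpha>s \<noteq> [] \<and> 0 \<notin> set \<alpha>s \<and> sum_list \<alpha>s = \<gamma> \<and>
          sorted_wrt (\<lambda>a b. slope \<theta> a = slope \<theta> b) \<alpha>s}"

text \<open>Total degree; used to see that the sums below are finite and the recursion terminates.\<close>

definition total_deg :: "nat ^ 'r::finite \<Rightarrow> nat" where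
  "total_deg a = (\<Sum>i\<in>UNIV. a $ i)"

lemma total_add: "total_deg (a + b) = total_deg a + total_deg b"
  by (simp add: total_deg_def sum.distrib)

lemma total_eq_0_iff: "total_deg a = 0 \<longleftrightarrow> a = 0"
  by (auto simp: total_deg_def vec_eq_iff)

lemma total_sum_list: "total_deg (sum_list as) = sum_list (map total_deg as)"
  by (induction as) (auto simp: total_add total_eq_0_iff)

lemma component_le_total: "a $ i \<le> total_deg a"
  unfolding total_deg_def by (rule member_le_sum) auto

lemma total_le_sum_list: "a \<in> set as \<Longrightarrow> total_deg a \<le> total_deg (sum_list as)"
  by (simp add: total_sum_list member_le_sum_list)

lemma length_le_total:
  "0 \<notin> set as \<Longrightarrow> length as \<le> total_deg (sum_list as)"
proof (induction as)
  case (Cons a as)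
  then have "total_deg a \<noteq> 0" by (auto simp: total_eq_0_iff)
  with Cons show ?case by (auto simp: total_add)
qed simp

lemma finite_total_le: "finite {a :: nat ^ 'r::finite. total_deg a \<le> n}"
proof -
  have "{a :: nat ^ 'r. total_deg a \<le> n} \<subseteq> vec_lambda ` (UNIV \<rightarrow>\<^sub>E {..n})"
  proof
    fix a :: "nat ^ 'r"
    assume "a \<in> {a. total_deg a \<le> n}"
    then have "vec_nth a \<in> UNIV \<rightarrow>\<^sub>E {..n}"
      using component_le_total[of a] by (auto intro: order_trans)
    then show "a \<in> vec_lambda ` (UNIV \<rightarrow>\<^sub>E {..n})"
      by (metis image_eqI vec_lambda_eta)
  qed
  moreover have "finite (vec_lambda ` ((UNIV :: 'r set) \<rightarrow>\<^sub>E {..n}) :: (nat ^ 'r) set)"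
    by (intro finite_imageI finite_PiE) auto
  ultimately show ?thesis by (rule finite_subset)
qed

lemma finite_decomps: "finite {\<alpha>s :: (nat ^ 'r::finite) list. 0 \<notin> set \<alpha>s \<and> sum_list \<alpha>s = \<gamma>}"
proof (rule finite_subset)
  show "{\<alpha>s. 0 \<notin> set \<alpha>s \<and> sum_list \<alpha>s = \<gamma>}
      \<subseteq> {\<alpha>s. set \<alpha>s \<subseteq> {a. total_deg a \<le> total_deg \<gamma>} \<and> length \<alpha>s \<le> total_deg \<gamma>}"
    using total_le_sum_list length_le_total by blast
  show "finite {\<alpha>s. set \<alpha>s \<subseteq> {a. total_deg a \<le> total_deg \<gamma>} \<and> length \<alpha>s \<le> total_deg \<gamma>}"
    by (rule finite_lists_length_le[OF finite_total_le])
qed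

lemma finite_decreasing_decomps: "finite (decreasing_decomps \<theta> \<gamma>)"
  by (rule finite_subset[OF _ finite_decomps[of \<gamma>]]) (auto simp: decreasing_decomps_def)

lemma finite_equal_slope_decomps: "finite (equal_slope_decomps \<theta> \<gamma>)"
  by (rule finite_subset[OF _ finite_decomps[of \<gamma>]]) (auto simp: equal_slope_decomps_def)

lemma total_less_of_decomp:
  assumes "0 \<notin> set \<alpha>s" "length \<alpha>s \<noteq> 1" "a \<in> set \<alpha>s"
  shows "total_deg a < total_deg (sum_list \<alpha>s)"
proof -
  obtain xs ys where s: "\<alpha>s = xs @ a # ys" using assms(3) by (meson split_list)
  have "length (xs @ ys) \<le> total_deg (sum_list (xs @ ys))"
    using assms(1) s by (intro length_le_total) auto
  moreover have "length (xs @ ys) > 0" using assms(2) s by auto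
  ultimately have "0 < total_deg (sum_list (xs @ ys))" by linarith
  then show ?thesis using s by (simp add: total_add)
qed

text \<open>
  The recursion determining \<open>A\<^sub>\<theta>\<close>, solved for the summand belonging to the one-term decomposition
  of \<open>\<gamma>\<close>. Its original form is \<open>stable_inv_recursion\<close> below.
\<close>

function stable_inv ::
    "(nat ^ 'r::finite \<Rightarrow> 'a::{ring, monoid_mult}) \<Rightarrow> real ^ 'r \<Rightarrow> nat ^ 'r \<Rightarrow> 'a" where
  "stable_inv A \<theta> \<gamma> =
     A \<gamma> - (\<Sum>\<alpha>s \<in> {\<alpha>s \<in> decreasing_decomps \<theta> \<gamma>. length \<alpha>s \<noteq> 1}.
              prod_list (map (\<lambda>\<alpha>. stable_inv A \<theta> \<alpha>) \<alpha>s))"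
  by pat_completeness auto
termination
  by (relation "Wellfounded.measure (\<lambda>(A, \<theta>, \<gamma>). total_deg \<gamma>)")
     (auto simp: decreasing_decomps_def total_less_of_decomp)

declare stable_inv.simps [simp del]

lemma decreasing_decomps_split:
  assumes "\<gamma> \<noteq> 0"
  shows "decreasing_decomps \<theta> \<gamma> =
    insert [\<gamma>] {\<alpha>s \<in> decreasing_decomps \<theta> \<gamma>. length \<alpha>s \<noteq> 1}"
  using assms by (auto simp: decreasing_decomps_def length_Suc_conv)

theorem stable_inv_recursion:
  assumes "\<gamma> \<noteq> 0"
  shows "A \<gamma> = (\<Sum>\<alpha>s \<in> decreasing_decomps \<theta> \<gamma>. prod_list (map (stable_inv A \<theta>) \<alpha>s))"
proof -
  have "(\<Sum>\<alpha>s \<in> decreasing_decomps \<theta> \<gamma>. prod_list (map (stable_inv A \<theta>) \<alpha>s)) =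
    stable_inv A \<theta> \<gamma> + (\<Sum>\<alpha>s \<in> {\<alpha>s \<in> decreasing_decomps \<theta> \<gamma>. length \<alpha>s \<noteq> 1}.
      prod_list (map (stable_inv A \<theta>) \<alpha>s))"
    by (subst decreasing_decomps_split[OF assms], subst sum.insert)
       (use finite_decreasing_decomps[of \<theta> \<gamma>] in auto)
  then show ?thesis by (simp add: stable_inv.simps[of A \<theta> \<gamma>])
qed

theorem stable_inv_unique:
  assumes F: "\<And>\<gamma>. \<gamma> \<noteq> 0 \<Longrightarrow> A \<gamma> = (\<Sum>\<alpha>s \<in> decreasing_decomps \<theta> \<gamma>. prod_list (map F \<alpha>s))"
    and "\<gamma> \<noteq> 0"
  shows "F \<gamma> = stable_inv A \<theta> \<gamma>"
  using \<open>\<gamma> \<noteq> 0\<close>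
proof (induction "total_deg \<gamma>" arbitrary: \<gamma> rule: less_induct)
  case less
  let ?D = "{\<alpha>s \<in> decreasing_decomps \<theta> \<gamma>. length \<alpha>s \<noteq> 1}"
  have split: "(\<Sum>\<alpha>s \<in> decreasing_decomps \<theta> \<gamma>. prod_list (map G \<alpha>s)) =
      G \<gamma> + (\<Sum>\<alpha>s \<in> ?D. prod_list (map G \<alpha>s))" for G :: "nat ^ 'a \<Rightarrow> 'b"
    by (subst decreasing_decomps_split[OF less.prems], subst sum.insert)
       (use finite_decreasing_decomps[of \<theta> \<gamma>] in auto)
  have "(\<Sum>\<alpha>s \<in> ?D. prod_list (map F \<alpha>s)) =
      (\<Sum>\<alpha>s \<in> ?D. prod_list (map (stable_inv A \<theta>) \<alpha>s))"
  proof (rule sum.cong[OF refl])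
    fix \<alpha>s assume a: "\<alpha>s \<in> ?D"
    have "map F \<alpha>s = map (stable_inv A \<theta>) \<alpha>s"
    proof (rule map_cong[OF refl])
      fix \<alpha> assume "\<alpha> \<in> set \<alpha>s"
      with a have "total_deg \<alpha> < total_deg \<gamma>" "\<alpha> \<noteq> 0"
        using total_less_of_decomp[of \<alpha>s \<alpha>] by (auto simp: decreasing_decomps_def)
      then show "F \<alpha> = stable_inv A \<theta> \<alpha>" by (rule less.hyps)
    qed
    then show "prod_list (map F \<alpha>s) = prod_list (map (stable_inv A \<theta>) \<alpha>s)" by (simp only:)
  qed
  with F[OF less.prems] stable_inv_recursion[OF less.prems, of A \<theta>]
  show ?case unfolding split by simp
qed

definition log_inv ::
    "(rat \<Rightarrow> 'a \<Rightarrow> 'a) \<Rightarrow> (nat ^ 'r::finite \<Rightarrow> 'a::{ring, monoid_mult}) \<Rightarrow>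
     real ^ 'r \<Rightarrow> nat ^ 'r \<Rightarrow> 'a" where
  "log_inv smul A \<theta> \<gamma> =
     (\<Sum>\<alpha>s \<in> equal_slope_decomps \<theta> \<gamma>.
        smul ((-1) ^ (length \<alpha>s - 1) / of_nat (length \<alpha>s)) (prod_list (map (stable_inv A \<theta>) \<alpha>s)))"

text \<open>
  The common value of \<open>log_inv\<close> at all generic parameters sufficiently close to \<open>\<langle>-, \<gamma>\<rangle>\<close>. At most
  one \<open>x\<close> has the property below because generic parameters are dense (\<open>generic_dense\<close>).
\<close>

definition attractor_inv ::
    "(rat \<Rightarrow> 'a \<Rightarrow> 'a) \<Rightarrow> (int ^ 'r \<Rightarrow> int ^ 'r \<Rightarrow> int) \<Rightarrow>
     (nat ^ 'r::finite \<Rightarrow> 'a::{ring, monoid_mult}) \<Rightarrow> nat ^ 'r \<Rightarrow> 'a" where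
  "attractor_inv smul form A \<gamma> =
     (THE x. \<exists>\<epsilon>>0. \<forall>\<theta>'. generic \<theta>' \<and> dist \<theta>' (attractor_stability form \<gamma>) < \<epsilon> \<longrightarrow>
        log_inv smul A \<theta>' \<gamma> = x)"

lemma generic_dense:
  fixes \<theta> :: "real ^ 'r::finite"
  assumes "\<epsilon> > 0"
  shows "\<exists>\<theta>'. generic \<theta>' \<and> dist \<theta>' \<theta> < \<epsilon>"
proof (rule ccontr)
  assume no: "\<not> ?thesis"
  define v :: "(nat ^ 'r) \<times> (nat ^ 'r) \<Rightarrow> real ^ 'r" where
    "v = (\<lambda>(a, b). \<chi> i. real (a $ i) / real (total_deg a) - real (b $ i) / real (total_deg b))"
  define P :: "((nat ^ 'r) \<times> (nat ^ 'r)) set" where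
    "P = {(a, b). a \<noteq> 0 \<and> b \<noteq> 0 \<and> \<not> proportional a b}"
  have v: "slope t a - slope t b = v (a, b) \<bullet> t" for t a b
  proof -
    have "v (a, b) \<bullet> t =
        (\<Sum>i\<in>UNIV. t $ i * real (a $ i) / real (total_deg a) -
          t $ i * real (b $ i) / real (total_deg b))"
      unfolding v_def inner_vec_def
      by (rule sum.cong) (simp_all add: left_diff_distrib mult.commute[of "t $ _"])
    also have "\<dots> = slope t a - slope t b"
      by (simp add: slope_def total_deg_def sum_subtractf sum_divide_distrib)
    finally show ?thesis by simp
  qed
  have nz: "v p \<noteq> 0" if "p \<in> P" for p
  proof
    obtain a b where p: "p = (a, b)" by force
    assume "v p = 0"
    then have "real (a $ i) / real (total_deg a) = real (b $ i) / real (total_deg b)" for i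
      by (auto simp: p v_def vec_eq_iff)
    moreover have "total_deg a \<noteq> 0" using that p by (auto simp: P_def total_eq_0_iff)
    ultimately have "real (a $ i) = (real (total_deg a) / real (total_deg b)) * real (b $ i)" for i
      by (simp add: field_simps)
    then have "proportional a b" unfolding proportional_def by blast
    with that p show False by (simp add: P_def)
  qed
  have "negligible (\<Union>p\<in>P. {t. v p \<bullet> t = 0})"
  proof (rule negligible_countable_Union)
    show "countable ((\<lambda>p. {t. v p \<bullet> t = 0}) ` P)" by (intro countable_image countableI_type)
    show "\<And>s. s \<in> (\<lambda>p. {t. v p \<bullet> t = 0}) ` P \<Longrightarrow> negligible s"
      using nz by (auto intro!: negligible_hyperplane)
  qed
  moreover have "ball \<theta> \<epsilon> \<subseteq> (\<Union>p\<in>P. {t. v p \<bullet> t = 0})"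
  proof
    fix t assume "t \<in> ball \<theta> \<epsilon>"
    with no have "\<not> generic t" by (auto simp: dist_commute)
    then obtain a b where "a \<noteq> 0" "b \<noteq> 0" "slope t a = slope t b" "\<not> proportional a b"
      by (auto simp: generic_def)
    then have "(a, b) \<in> P" "v (a, b) \<bullet> t = 0" using v[of t a b] by (auto simp: P_def)
    then show "t \<in> (\<Union>p\<in>P. {t. v p \<bullet> t = 0})" by blast
  qed
  ultimately have "negligible (ball \<theta> \<epsilon>)" by (rule negligible_subset)
  then show False
    using assms open_not_negligible[of "ball \<theta> \<epsilon>"] by simp
qed

end

theory Submission
  imports Defs
begin

text \<open>
  Put \<open>\<theta> = \<langle>-, \<gamma>\<rangle>\<close> and let \<open>\<theta>'\<close> be close to \<open>\<theta>\<close>. In noncommutative power series over the monoid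
  of degrees, the recursion for the invariants says that \<open>1 + \<Sum> A \<alpha>\<close> is a product, over all slopes
  in decreasing order, of factors \<open>1 + \<Sum> A\<^sub>\<theta> \<alpha>\<close> with \<open>\<alpha>\<close> of the given slope
  (\<open>coeff_ordered_prod_slope\<close>). Up to the total degree of \<open>\<gamma>\<close>, the order by \<open>\<theta>'\<close>-slope refines the
  order by \<open>\<theta>\<close>-slope. Bracketing the \<open>\<theta>'\<close>-product by \<open>\<theta>\<close>-slope must therefore give the
  \<open>\<theta>\<close>-product, because the factorization is unique (\<open>slope_class_eq\<close>, \<open>sum_coarse\<close>): the factor for
  \<open>\<theta>\<close> of slope \<open>\<mu>\<^sub>\<theta>(\<gamma>) = 0\<close> is the ordered product of the factors for \<open>\<theta>'\<close> whose degrees \<open>\<alpha>\<close>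
  satisfy \<open>\<langle>\<alpha>, \<gamma>\<rangle> = 0\<close>.

  The invariants \<open>log_inv\<close> are the coefficients of the logarithms of these factors. If \<open>\<alpha> + \<beta> = \<gamma>\<close> and
  \<open>\<langle>\<alpha>, \<gamma>\<rangle> = 0\<close>, then \<open>\<langle>\<alpha>, \<beta>\<rangle> = \<langle>\<alpha>, \<gamma>\<rangle> - \<langle>\<alpha>, \<alpha>\<rangle> = 0\<close> and the components of degrees \<open>\<alpha>\<close> and
  \<open>\<beta>\<close> commute. So the coefficient at \<open>\<gamma>\<close> is a trace on series supported in degrees orthogonal to
  \<open>\<gamma>\<close>, and the logarithm under a trace is additive on products (\<open>log_coeff_mult\<close>). This is shown
  through the logarithmic derivative for the Euler derivation, which multiplies degree \<open>\<gamma>\<close> by a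
  nonzero integer. Among the factors for \<open>\<theta>'\<close> only the one of slope \<open>\<mu>\<^sub>\<theta>\<^sub>'(\<gamma>)\<close> has a nonzero logarithm
  in degree \<open>\<gamma>\<close>, and its coefficient there is the invariant for \<open>\<theta>'\<close>.
\<close>

section \<open>Noncommutative power series\<close>

definition splits :: "nat ^ 'r::finite \<Rightarrow> ((nat ^ 'r) \<times> (nat ^ 'r)) set" where
  "splits \<gamma> = {(\<alpha>, \<beta>). \<alpha> + \<beta> = \<gamma>}"

lemma finite_splits [simp]: "finite (splits \<gamma>)"
proof (rule finite_subset)
  show "splits \<gamma> \<subseteq> {a. total_deg a \<le> total_deg \<gamma>} \<times> {a. total_deg a \<le> total_deg \<gamma>}"
    by (auto simp: splits_def total_add)
qed (simp add: finite_total_le)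

lemma vec_add_eq_0_iff: "\<alpha> + \<beta> = 0 \<longleftrightarrow> \<alpha> = 0 \<and> \<beta> = (0 :: nat ^ 'r::finite)"
  by (auto simp: vec_eq_iff)

lemma splits_0 [simp]: "splits 0 = {(0, 0)}"
  by (auto simp: splits_def vec_add_eq_0_iff)

text \<open>
  Formal sums of coefficients over all degrees, with convolution as multiplication. A degree splits
  into two degrees in finitely many ways, so infinitely many nonzero coefficients are harmless. A type
  of their own, instead of plain functions, lets series carry this multiplication as a ring instance.
\<close>

datatype ('a, 'r::finite) series = Series (coeff: "nat ^ 'r \<Rightarrow> 'a")

lemma series_eqI: "(\<And>\<beta>. coeff f \<beta> = coeff g \<beta>) \<Longrightarrow> f = g"
  by (metis ext series.expand)

instantiation series :: (ring, finite) ring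
begin

definition "0 = Series (\<lambda>_. 0)"
definition "f + g = Series (\<lambda>\<beta>. coeff f \<beta> + coeff g \<beta>)"
definition "f - g = Series (\<lambda>\<beta>. coeff f \<beta> - coeff g \<beta>)"
definition "- f = Series (\<lambda>\<beta>. - coeff f \<beta>)"
definition "f * g = Series (\<lambda>\<gamma>. \<Sum>(\<alpha>, \<beta>) \<in> splits \<gamma>. coeff f \<alpha> * coeff g \<beta>)"

instance
proof
  fix f g h :: "('a, 'b) series"
  show "f * g * h = f * (g * h)"
  proof (rule series_eqI)
    fix \<gamma> :: "nat ^ 'b"
    have "coeff (f * g * h) \<gamma> = (\<Sum>(\<delta>, \<beta>) \<in> splits \<gamma>. \<Sum>(\<alpha>, \<alpha>') \<in> splits \<delta>.
        coeff f \<alpha> * coeff g \<alpha>' * coeff h \<beta>)"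
      by (simp add: times_series_def sum_distrib_right case_prod_unfold)
    also have "\<dots> = (\<Sum>(p, p') \<in> Sigma (splits \<gamma>) (\<lambda>p. splits (fst p)).
        coeff f (fst p') * coeff g (snd p') * coeff h (snd p))"
      by (subst sum.Sigma[symmetric]) (auto simp: case_prod_unfold)
    also have "\<dots> = (\<Sum>(p, p') \<in> Sigma (splits \<gamma>) (\<lambda>p. splits (snd p)).
        coeff f (fst p) * (coeff g (fst p') * coeff h (snd p')))"
      by (rule sum.reindex_bij_witness[of _
            "\<lambda>(p, p'). ((fst p + fst p', snd p'), (fst p, fst p'))"
            "\<lambda>(p, p'). ((fst p', snd p' + snd p), (snd p', snd p))"])
        (auto simp: splits_def algebra_simps)
    also have "\<dots> = (\<Sum>(\<alpha>, \<delta>) \<in> splits \<gamma>. \<Sum>(\<alpha>', \<beta>) \<in> splits \<delta>.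
        coeff f \<alpha> * (coeff g \<alpha>' * coeff h \<beta>))"
      by (subst sum.Sigma[symmetric]) (auto simp: case_prod_unfold)
    also have "\<dots> = coeff (f * (g * h)) \<gamma>"
      by (simp add: times_series_def sum_distrib_left case_prod_unfold)
    finally show "coeff (f * g * h) \<gamma> = coeff (f * (g * h)) \<gamma>" .
  qed
qed (auto simp: zero_series_def plus_series_def minus_series_def uminus_series_def
      times_series_def algebra_simps sum.distrib case_prod_unfold intro!: series_eqI)

end

lemma coeff_ring_ops [simp]:
  "coeff 0 \<beta> = 0"
  "coeff (f + g) \<beta> = coeff f \<beta> + coeff g \<beta>"
  "coeff (f - g) \<beta> = coeff f \<beta> - coeff g \<beta>"
  "coeff (- f) \<beta> = - coeff f \<beta>"
  by (simp_all add: zero_series_def plus_series_def minus_series_def uminus_series_def)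

lemma coeff_mult: "coeff (f * g) \<gamma> = (\<Sum>(\<alpha>, \<beta>) \<in> splits \<gamma>. coeff f \<alpha> * coeff g \<beta>)"
  by (simp add: times_series_def)

lemma coeff_mult_0 [simp]: "coeff (f * g) 0 = coeff f 0 * coeff g 0"
  by (simp add: coeff_mult)

lemma coeff_sum: "coeff (sum f I) \<beta> = (\<Sum>i\<in>I. coeff (f i) \<beta>)"
  by (induction I rule: infinite_finite_induct) auto

instantiation series :: ("{ring, monoid_mult}", finite) monoid_mult
begin

definition "1 = Series (\<lambda>\<beta>. if \<beta> = 0 then 1 else 0)"

instance
proof
  fix f :: "('a, 'b) series"
  have "(\<Sum>(\<alpha>, \<beta>) \<in> splits \<gamma>. (if \<alpha> = 0 then 1 else 0) * coeff f \<beta>) = coeff f \<gamma>" for \<gamma>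
    by (subst sum.mono_neutral_right[of _ "{(0, \<gamma>)}", OF finite_splits])
      (auto simp: splits_def split: if_splits)
  then show "1 * f = f"
    by (auto simp: one_series_def times_series_def intro!: series_eqI)
  have "(\<Sum>(\<alpha>, \<beta>) \<in> splits \<gamma>. coeff f \<alpha> * (if \<beta> = 0 then 1 else 0)) = coeff f \<gamma>" for \<gamma>
    by (subst sum.mono_neutral_right[of _ "{(\<gamma>, 0)}", OF finite_splits])
      (auto simp: splits_def split: if_splits)
  then show "f * 1 = f"
    by (auto simp: one_series_def times_series_def intro!: series_eqI)
qed

end

lemma coeff_one: "coeff 1 \<beta> = (if \<beta> = 0 then 1 else 0)"
  by (simp add: one_series_def)

definition order_ge :: "nat \<Rightarrow> ('a::ring, 'r::finite) series \<Rightarrow> bool" where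
  "order_ge n f \<longleftrightarrow> (\<forall>\<beta>. total_deg \<beta> < n \<longrightarrow> coeff f \<beta> = 0)"

lemma order_ge_mult:
  assumes "order_ge m f" "order_ge n g"
  shows "order_ge (m + n) (f * g)"
  unfolding order_ge_def
proof (intro allI impI)
  fix \<gamma> :: "nat ^ 'b" assume \<gamma>: "total_deg \<gamma> < m + n"
  show "coeff (f * g) \<gamma> = 0"
    unfolding coeff_mult
  proof (rule sum.neutral, safe)
    fix \<alpha> \<beta> :: "nat ^ 'b" assume "(\<alpha>, \<beta>) \<in> splits \<gamma>"
    then have "total_deg \<alpha> < m \<or> total_deg \<beta> < n"
      using \<gamma> by (auto simp: splits_def total_add)
    then show "coeff f \<alpha> * coeff g \<beta> = 0"
      using assms by (auto simp: order_ge_def)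
  qed
qed

lemma order_ge_1_iff: "order_ge 1 f \<longleftrightarrow> coeff f 0 = 0"
  by (auto simp: order_ge_def total_eq_0_iff)

lemma order_ge_power:
  fixes f :: "('a::{ring, monoid_mult}, 'r::finite) series"
  assumes "coeff f 0 = 0"
  shows "order_ge n (f ^ n)"
proof (induction n)
  case (Suc n)
  then show ?case
    using order_ge_mult[of 1 f n "f ^ n"] assms order_ge_1_iff[of f] by simp
qed (simp add: order_ge_def)

lemma geometric_sum_series:
  fixes x :: "('a::{ring, monoid_mult}, 'r::finite) series"
  shows "(\<Sum>n<N. (- x) ^ n) * (1 + x) = 1 - (- x) ^ N"
    and "(1 + x) * (\<Sum>n<N. (- x) ^ n) = 1 - (- x) ^ N"
proof -
  show "(\<Sum>n<N. (- x) ^ n) * (1 + x) = 1 - (- x) ^ N"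
    by (induction N) (simp_all add: algebra_simps power_Suc2 del: power_Suc)
  show "(1 + x) * (\<Sum>n<N. (- x) ^ n) = 1 - (- x) ^ N"
    by (induction N) (simp_all add: algebra_simps)
qed

text \<open>
  The geometric series of \<open>- x\<close>. In degree \<open>\<beta>\<close> the powers beyond \<open>total_deg \<beta>\<close> vanish, so each
  coefficient is a finite sum.
\<close>

definition geometric_inverse ::
    "('a::{ring, monoid_mult}, 'r::finite) series \<Rightarrow> ('a, 'r) series" where
  "geometric_inverse x = Series (\<lambda>\<beta>. \<Sum>n<Suc (total_deg \<beta>). coeff ((- x) ^ n) \<beta>)"

lemma coeff_geometric_inverse:
  assumes "coeff x 0 = 0" "total_deg \<beta> < N"
  shows "coeff (geometric_inverse x) \<beta> = coeff (\<Sum>n<N. (- x) ^ n) \<beta>"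
  unfolding geometric_inverse_def coeff_sum series.sel
proof (rule sum.mono_neutral_left)
  show "\<forall>n \<in> {..<N} - {..<Suc (total_deg \<beta>)}. coeff ((- x) ^ n) \<beta> = 0"
    using order_ge_power[of "- x"] assms(1) by (auto simp: order_ge_def)
qed (use assms in auto)

lemma geometric_inverse:
  assumes "coeff x 0 = 0"
  shows "geometric_inverse x * (1 + x) = 1" and "(1 + x) * geometric_inverse x = 1"
proof -
  let ?s = "\<lambda>\<gamma>. \<Sum>n<Suc (total_deg \<gamma>). (- x) ^ n"
  have le: "total_deg \<alpha> < Suc (total_deg \<gamma>)" "total_deg \<beta> < Suc (total_deg \<gamma>)"
    if "(\<alpha>, \<beta>) \<in> splits \<gamma>" for \<alpha> \<beta> \<gamma> :: "nat ^ 'b"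
    using that by (auto simp: splits_def total_add)
  have van: "coeff ((- x) ^ Suc (total_deg \<gamma>)) \<gamma> = 0" for \<gamma>
    using order_ge_power[of "- x" "Suc (total_deg \<gamma>)"] assms by (auto simp: order_ge_def)
  have "coeff (geometric_inverse x * (1 + x)) \<gamma> = coeff (?s \<gamma> * (1 + x)) \<gamma>" for \<gamma>
    unfolding coeff_mult
    by (rule sum.cong) (use assms le coeff_geometric_inverse in \<open>force+\<close>)
  then show "geometric_inverse x * (1 + x) = 1"
    by (intro series_eqI) (simp add: geometric_sum_series van del: sum.lessThan_Suc power_Suc)
  have "coeff ((1 + x) * geometric_inverse x) \<gamma> = coeff ((1 + x) * ?s \<gamma>) \<gamma>" for \<gamma>
    unfolding coeff_mult
    by (rule sum.cong) (use assms le coeff_geometric_inverse in \<open>force+\<close>)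
  then show "(1 + x) * geometric_inverse x = 1"
    by (intro series_eqI) (simp add: geometric_sum_series van del: sum.lessThan_Suc power_Suc)
qed

section \<open>Ordered products and decompositions\<close>

text \<open>
  For a slope function \<open>h\<close>, the series \<open>1 + part h G t\<close> is the factor of slope \<open>t\<close> in the
  factorization of \<open>1 + \<Sum> A \<alpha>\<close> that defines the invariants \<open>G\<close>.
\<close>

definition part ::
    "(nat ^ 'r::finite \<Rightarrow> real) \<Rightarrow> (nat ^ 'r \<Rightarrow> 'a::ring) \<Rightarrow> real \<Rightarrow> ('a, 'r) series" where
  "part h G t = Series (\<lambda>\<alpha>. if \<alpha> \<noteq> 0 \<and> h \<alpha> = t then G \<alpha> else 0)"

lemma coeff_part: "coeff (part h G t) \<alpha> = (if \<alpha> \<noteq> 0 \<and> h \<alpha> = t then G \<alpha> else 0)"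
  by (simp add: part_def)

definition decomps :: "nat ^ 'r::finite \<Rightarrow> (nat ^ 'r) list set" where
  "decomps \<gamma> = {\<alpha>s. 0 \<notin> set \<alpha>s \<and> sum_list \<alpha>s = \<gamma>}"

lemma finite_decomps_set [simp]: "finite (decomps \<gamma>)"
  unfolding decomps_def by (rule finite_decomps)

lemma coeff_part_mult:
  assumes "\<And>\<beta>. coeff f \<beta> = (\<Sum>\<alpha>s \<in> {\<alpha>s \<in> decomps \<beta>. P \<alpha>s}. prod_list (map G \<alpha>s))"
  shows "coeff (part h G t * f) \<gamma> =
    (\<Sum>\<alpha>s \<in> {\<alpha>s \<in> decomps \<gamma>. \<alpha>s \<noteq> [] \<and> h (hd \<alpha>s) = t \<and> P (tl \<alpha>s)}. prod_list (map G \<alpha>s))"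
proof -
  let ?S = "{(\<alpha>, \<beta>). (\<alpha>, \<beta>) \<in> splits \<gamma> \<and> \<alpha> \<noteq> 0 \<and> h \<alpha> = t}"
  have fin: "finite ?S" by (rule finite_subset[of _ "splits \<gamma>"]) auto
  have "coeff (part h G t * f) \<gamma> = (\<Sum>(\<alpha>, \<beta>) \<in> ?S. G \<alpha> * coeff f \<beta>)"
    unfolding coeff_mult
    by (rule sum.mono_neutral_cong_right) (auto simp: coeff_part split: if_splits)
  also have "\<dots> = (\<Sum>p \<in> ?S. \<Sum>\<alpha>s \<in> {\<alpha>s \<in> decomps (snd p). P \<alpha>s}. G (fst p) * prod_list (map G \<alpha>s))"
    by (simp add: assms sum_distrib_left case_prod_unfold)
  also have "\<dots> = (\<Sum>(p, \<alpha>s) \<in> Sigma ?S (\<lambda>p. {\<alpha>s \<in> decomps (snd p). P \<alpha>s}).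
      G (fst p) * prod_list (map G \<alpha>s))"
    by (rule sum.Sigma) (use fin in auto)
  also have "\<dots> = (\<Sum>\<alpha>s \<in> {\<alpha>s \<in> decomps \<gamma>. \<alpha>s \<noteq> [] \<and> h (hd \<alpha>s) = t \<and> P (tl \<alpha>s)}.
      prod_list (map G \<alpha>s))"
    by (rule sum.reindex_bij_witness[of _
          "\<lambda>\<alpha>s. ((hd \<alpha>s, sum_list (tl \<alpha>s)), tl \<alpha>s)" "\<lambda>(p, \<alpha>s). fst p # \<alpha>s"])
      (auto simp: splits_def decomps_def neq_Nil_conv)
  finally show ?thesis .
qed

lemma coeff_one_decomps:
  "coeff 1 \<beta> = (\<Sum>\<alpha>s \<in> {\<alpha>s \<in> decomps \<beta>. \<alpha>s = []}. prod_list (map G \<alpha>s))"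
proof (cases "\<beta> = 0")
  case True
  then have "{\<alpha>s \<in> decomps \<beta>. \<alpha>s = []} = {[]}" by (auto simp: decomps_def)
  with True show ?thesis by (simp add: coeff_one)
next
  case False
  then have "{\<alpha>s \<in> decomps \<beta>. \<alpha>s = []} = {}" by (auto simp: decomps_def)
  then show ?thesis using False by (simp only: coeff_one) simp
qed

lemma coeff_part_power:
  "coeff (part h G t ^ n) \<gamma> =
    (\<Sum>\<alpha>s \<in> {\<alpha>s \<in> decomps \<gamma>. length \<alpha>s = n \<and> (\<forall>\<alpha>\<in>set \<alpha>s. h \<alpha> = t)}. prod_list (map G \<alpha>s))"
proof (induction n arbitrary: \<gamma>)
  case 0
  have "{\<alpha>s \<in> decomps \<gamma>. length \<alpha>s = 0 \<and> (\<forall>\<alpha>\<in>set \<alpha>s. h \<alpha> = t)} = {\<alpha>s \<in> decomps \<gamma>. \<alpha>s = []}"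
    by auto
  then show ?case by (simp only: coeff_one_decomps[of _ G] power_0)
next
  case (Suc n)
  have "{\<alpha>s \<in> decomps \<gamma>. \<alpha>s \<noteq> [] \<and> h (hd \<alpha>s) = t \<and>
      (length (tl \<alpha>s) = n \<and> (\<forall>\<alpha>\<in>set (tl \<alpha>s). h \<alpha> = t))} =
    {\<alpha>s \<in> decomps \<gamma>. length \<alpha>s = Suc n \<and> (\<forall>\<alpha>\<in>set \<alpha>s. h \<alpha> = t)}"
    by (auto simp: neq_Nil_conv length_Suc_conv)
  then show ?case by (simp only: power_Suc coeff_part_mult[OF Suc])
qed

text \<open>
  Expanding the product chooses from each factor either \<open>1\<close> or one term of the given slope. As the
  slopes strictly decrease along \<open>ts\<close>, the chosen degrees form a list with strictly decreasing
  slopes, and every such list arises exactly once. In the induction the lists are separated by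
  whether their first entry has the largest slope.
\<close>

lemma coeff_ordered_prod:
  assumes "sorted_wrt (>) ts"
  shows "coeff (\<Prod>t\<leftarrow>ts. 1 + part h G t) \<gamma> =
    (\<Sum>\<alpha>s \<in> {\<alpha>s \<in> decomps \<gamma>. sorted_wrt (\<lambda>a b. h a > h b) \<alpha>s \<and> h ` set \<alpha>s \<subseteq> set ts}.
      prod_list (map G \<alpha>s))"
  using assms
proof (induction ts arbitrary: \<gamma>)
  case Nil
  have "{\<alpha>s \<in> decomps \<gamma>. sorted_wrt (\<lambda>a b. h a > h b) \<alpha>s \<and> h ` set \<alpha>s \<subseteq> set []} =
      {\<alpha>s \<in> decomps \<gamma>. \<alpha>s = []}"
    by auto
  then show ?case by (simp only: coeff_one_decomps[of _ G] list.map prod_list.Nil)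
next
  case (Cons t ts)
  let ?P = "\<lambda>ts \<alpha>s. sorted_wrt (\<lambda>a b. h a > h b) \<alpha>s \<and> h ` set \<alpha>s \<subseteq> set ts"
  let ?f = "\<Prod>t\<leftarrow>ts. 1 + part h G t"
  let ?hd = "{\<alpha>s \<in> decomps \<gamma>. \<alpha>s \<noteq> [] \<and> h (hd \<alpha>s) = t \<and> ?P ts (tl \<alpha>s)}"
  have IH: "coeff ?f \<beta> = (\<Sum>\<alpha>s \<in> {\<alpha>s \<in> decomps \<beta>. ?P ts \<alpha>s}. prod_list (map G \<alpha>s))" for \<beta>
    using Cons by simp
  have ts: "\<And>u. u \<in> set ts \<Longrightarrow> u < t" using Cons.prems by simp
  have "?P (t # ts) \<alpha>s \<longleftrightarrow> ?P ts \<alpha>s \<or> \<alpha>s \<noteq> [] \<and> h (hd \<alpha>s) = t \<and> ?P ts (tl \<alpha>s)" for \<alpha>s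
    using ts by (cases \<alpha>s) fastforce+
  then have un: "{\<alpha>s \<in> decomps \<gamma>. ?P (t # ts) \<alpha>s} = {\<alpha>s \<in> decomps \<gamma>. ?P ts \<alpha>s} \<union> ?hd"
    by blast
  have disj: "{\<alpha>s \<in> decomps \<gamma>. ?P ts \<alpha>s} \<inter> ?hd = {}"
    using ts by (fastforce simp: neq_Nil_conv)
  have "coeff (\<Prod>t\<leftarrow>t # ts. 1 + part h G t) \<gamma> = coeff ?f \<gamma> + coeff (part h G t * ?f) \<gamma>"
    by (simp add: distrib_right)
  also have "\<dots> = (\<Sum>\<alpha>s \<in> {\<alpha>s \<in> decomps \<gamma>. ?P ts \<alpha>s}. prod_list (map G \<alpha>s)) +
      (\<Sum>\<alpha>s \<in> ?hd. prod_list (map G \<alpha>s))"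
    by (simp only: IH coeff_part_mult[OF IH])
  also have "\<dots> = (\<Sum>\<alpha>s \<in> {\<alpha>s \<in> decomps \<gamma>. ?P (t # ts) \<alpha>s}. prod_list (map G \<alpha>s))"
    unfolding un by (rule sum.union_disjoint[symmetric]) (use disj in auto)
  finally show ?case .
qed

lemma prod_list_eq_0:
  fixes G :: "'b \<Rightarrow> 'a::{ring, monoid_mult}"
  shows "a \<in> set as \<Longrightarrow> G a = 0 \<Longrightarrow> prod_list (map G as) = 0"
  by (induction as) auto

text \<open>
  If \<open>ts\<close> contains every slope that \<open>G\<close> sees, the product is the right-hand side of the recursion
  that determines \<open>stable_inv\<close>.
\<close>

lemma coeff_ordered_prod_slope:
  assumes "sorted_wrt (>) ts" and "\<gamma> \<noteq> 0"
    and "\<And>\<alpha>. \<alpha> \<noteq> 0 \<Longrightarrow> slope \<theta> \<alpha> \<notin> set ts \<Longrightarrow> G \<alpha> = 0"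
  shows "coeff (\<Prod>t\<leftarrow>ts. 1 + part (slope \<theta>) G t) \<gamma> =
    (\<Sum>\<alpha>s \<in> decreasing_decomps \<theta> \<gamma>. prod_list (map G \<alpha>s))"
  unfolding coeff_ordered_prod[OF assms(1)]
proof (rule sum.mono_neutral_left)
  show "{\<alpha>s \<in> decomps \<gamma>. sorted_wrt (\<lambda>a b. slope \<theta> b < slope \<theta> a) \<alpha>s \<and>
      slope \<theta> ` set \<alpha>s \<subseteq> set ts} \<subseteq> decreasing_decomps \<theta> \<gamma>"
    using assms(2) by (auto simp: decomps_def decreasing_decomps_def)
  show "\<forall>\<alpha>s \<in> decreasing_decomps \<theta> \<gamma> - {\<alpha>s \<in> decomps \<gamma>.
      sorted_wrt (\<lambda>a b. slope \<theta> b < slope \<theta> a) \<alpha>s \<and> slope \<theta> ` set \<alpha>s \<subseteq> set ts}.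
      prod_list (map G \<alpha>s) = 0"
  proof
    fix \<alpha>s assume "\<alpha>s \<in> decreasing_decomps \<theta> \<gamma> - {\<alpha>s \<in> decomps \<gamma>.
      sorted_wrt (\<lambda>a b. slope \<theta> b < slope \<theta> a) \<alpha>s \<and> slope \<theta> ` set \<alpha>s \<subseteq> set ts}"
    then obtain \<alpha> where "\<alpha> \<in> set \<alpha>s" "\<alpha> \<noteq> 0" "slope \<theta> \<alpha> \<notin> set ts"
      by (auto simp: decomps_def decreasing_decomps_def)
    with assms(3) show "prod_list (map G \<alpha>s) = 0" by (blast intro: prod_list_eq_0)
  qed
qed (rule finite_decreasing_decomps)

section \<open>The logarithm under a trace\<close>

text \<open>
  The situation in degree \<open>\<gamma>\<close> of the theorem, where \<open>C\<close> consists of the degrees that pair to zero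
  with \<open>\<gamma>\<close>. Two such degrees with sum \<open>\<gamma>\<close> pair to zero with each other, so their components
  commute. On series supported in \<open>C\<close>, taking the coefficient at \<open>\<gamma>\<close> is therefore a trace.
\<close>

locale commuting_degree = graded_rat_algebra smul R
  for smul :: "rat \<Rightarrow> 'a::{ring, monoid_mult} \<Rightarrow> 'a" and R :: "nat ^ 'r::finite \<Rightarrow> 'a set" +
  fixes C :: "(nat ^ 'r) set" and \<gamma> :: "nat ^ 'r"
  assumes degree_nonzero: "\<gamma> \<noteq> 0"
    and C_add: "\<alpha> \<in> C \<Longrightarrow> \<beta> \<in> C \<Longrightarrow> \<alpha> + \<beta> \<in> C"
    and C_commute: "\<alpha> \<in> C \<Longrightarrow> \<beta> \<in> C \<Longrightarrow> \<alpha> + \<beta> = \<gamma> \<Longrightarrow> x \<in> R \<alpha> \<Longrightarrow> y \<in> R \<beta> \<Longrightarrow> x * y = y * x"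
begin

text \<open>
  In degree \<open>0\<close> only scalars are admitted. They commute with everything, they contain the constant
  terms of all series in use, and nonzero degrees never add up to \<open>0\<close>, so products stay inside.
\<close>

definition scalar_component :: "nat ^ 'r \<Rightarrow> 'a set" where
  "scalar_component \<beta> = (if \<beta> = 0 then range (\<lambda>q. smul q 1) else if \<beta> \<in> C then R \<beta> else {0})"

definition homogeneous :: "('a, 'r) series \<Rightarrow> bool" where
  "homogeneous f \<longleftrightarrow> (\<forall>\<beta>. coeff f \<beta> \<in> scalar_component \<beta>)"

lemma smul_one_mult: "smul q 1 * x = smul q x" "x * smul q 1 = smul q x"
  by (simp_all add: smul_mult_left smul_mult_right)

lemma subspace_scalar_component: "subspace (scalar_component \<beta>)"
proof (cases "\<beta> = 0")
  case True
  have "subspace (range (\<lambda>q. smul q (1 :: 'a)))"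
    by (auto simp: subspace_def intro: range_eqI[of _ _ 0] simp flip: scale_left_distrib)
  with True show ?thesis by (simp add: scalar_component_def)
next
  case False
  then show ?thesis by (simp add: scalar_component_def subspace_component subspace_single_0)
qed

lemma scalar_component_mult:
  assumes "x \<in> scalar_component \<alpha>" "y \<in> scalar_component \<beta>"
  shows "x * y \<in> scalar_component (\<alpha> + \<beta>)"
proof (cases "\<alpha> = 0 \<or> \<beta> = 0")
  case True
  then show ?thesis
  proof
    assume \<alpha>: "\<alpha> = 0"
    then obtain q where "x = smul q 1" using assms(1) by (auto simp: scalar_component_def)
    then show ?thesis
      using subspace_scale[OF subspace_scalar_component assms(2)] \<alpha> by (simp add: smul_one_mult)
  next
    assume \<beta>: "\<beta> = 0"
    then obtain q where "y = smul q 1" using assms(2) by (auto simp: scalar_component_def)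
    then show ?thesis
      using subspace_scale[OF subspace_scalar_component assms(1)] \<beta> by (simp add: smul_one_mult)
  qed
next
  case False
  then have nz: "\<alpha> + \<beta> \<noteq> 0" by (simp add: vec_add_eq_0_iff)
  have z: "0 \<in> scalar_component (\<alpha> + \<beta>)" by (rule subspace_0[OF subspace_scalar_component])
  show ?thesis
  proof (cases "\<alpha> \<in> C \<and> \<beta> \<in> C")
    case True
    then show ?thesis using assms False nz by (auto simp: scalar_component_def mult_component C_add)
  next
    case notC: False
    then have "x * y = 0" using assms False by (auto simp: scalar_component_def split: if_splits)
    then show ?thesis using z by simp
  qed
qed

lemma scalar_component_commute:
  assumes "x \<in> scalar_component \<alpha>" "y \<in> scalar_component \<beta>" "\<alpha> + \<beta> = \<gamma>"
  shows "x * y = y * x"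
proof (cases "\<alpha> = 0 \<or> \<beta> = 0")
  case True
  then show ?thesis using assms by (auto simp: scalar_component_def smul_one_mult)
next
  case False
  show ?thesis
  proof (cases "\<alpha> \<in> C \<and> \<beta> \<in> C")
    case True
    then show ?thesis using C_commute assms False by (auto simp: scalar_component_def)
  next
    case notC: False
    then show ?thesis using assms False by (auto simp: scalar_component_def split: if_splits)
  qed
qed

lemma homogeneous_0: "homogeneous 0"
  by (simp add: homogeneous_def subspace_0[OF subspace_scalar_component])

lemma homogeneous_1: "homogeneous 1"
proof -
  have "1 \<in> scalar_component 0"
    unfolding scalar_component_def by (auto intro: range_eqI[of _ _ 1])
  then show ?thesis
    by (auto simp: homogeneous_def coeff_one subspace_0[OF subspace_scalar_component])
qed

lemma homogeneous_add: "homogeneous f \<Longrightarrow> homogeneous g \<Longrightarrow> homogeneous (f + g)"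
  by (auto simp: homogeneous_def intro: subspace_add[OF subspace_scalar_component])

lemma homogeneous_minus: "homogeneous f \<Longrightarrow> homogeneous (- f)"
  by (auto simp: homogeneous_def intro: subspace_neg[OF subspace_scalar_component])

lemma homogeneous_mult:
  assumes "homogeneous f" "homogeneous g"
  shows "homogeneous (f * g)"
  unfolding homogeneous_def coeff_mult
proof (intro allI subspace_sum[OF subspace_scalar_component], safe)
  fix \<alpha> \<beta> \<delta> :: "nat ^ 'r" assume "(\<alpha>, \<beta>) \<in> splits \<delta>"
  then show "coeff f \<alpha> * coeff g \<beta> \<in> scalar_component \<delta>"
    using assms scalar_component_mult by (auto simp: homogeneous_def splits_def)
qed

lemma homogeneous_power: "homogeneous f \<Longrightarrow> homogeneous (f ^ n)"
  by (induction n) (auto intro: homogeneous_1 homogeneous_mult)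

lemma homogeneous_sum: "(\<And>i. i \<in> I \<Longrightarrow> homogeneous (f i)) \<Longrightarrow> homogeneous (sum f I)"
  by (induction I rule: infinite_finite_induct) (auto intro: homogeneous_0 homogeneous_add)

lemma homogeneous_geometric_inverse:
  assumes "homogeneous x" "coeff x 0 = 0"
  shows "homogeneous (geometric_inverse x)"
proof -
  have "homogeneous (\<Sum>n<N. (- x) ^ n)" for N
    by (intro homogeneous_sum homogeneous_power homogeneous_minus assms)
  then show ?thesis
    unfolding homogeneous_def using coeff_geometric_inverse[OF assms(2) lessI] by metis
qed

text \<open>
  The trace property. Both products pair the same components, in opposite order, and each pair of
  degrees adds up to \<open>\<gamma>\<close>.
\<close>

lemma coeff_mult_commute:
  assumes "homogeneous f" "homogeneous g"
  shows "coeff (f * g) \<gamma> = coeff (g * f) \<gamma>"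
proof -
  have "coeff (f * g) \<gamma> = (\<Sum>(\<alpha>, \<beta>) \<in> splits \<gamma>. coeff g \<beta> * coeff f \<alpha>)"
    unfolding coeff_mult
  proof (rule sum.cong[OF refl], safe)
    fix \<alpha> \<beta> assume "(\<alpha>, \<beta>) \<in> splits \<gamma>"
    then have "\<alpha> + \<beta> = \<gamma>" by (simp add: splits_def)
    then show "coeff f \<alpha> * coeff g \<beta> = coeff g \<beta> * coeff f \<alpha>"
      by (rule scalar_component_commute[rotated 2]) (use assms in \<open>auto simp: homogeneous_def\<close>)
  qed
  also have "\<dots> = coeff (g * f) \<gamma>"
    unfolding coeff_mult
    by (rule sum.reindex_bij_witness[of _ prod.swap prod.swap])
      (auto simp: splits_def add.commute)
  finally show ?thesis .
qed

text \<open>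
  The Euler derivation. It is the substitute for differentiation with respect to a parameter: on
  degree \<open>\<gamma>\<close> it is multiplication by the nonzero number \<open>total_deg \<gamma>\<close>, so a coefficient at \<open>\<gamma>\<close> can
  be recovered from its derivative.
\<close>

definition euler :: "('a, 'r) series \<Rightarrow> ('a, 'r) series" where
  "euler f = Series (\<lambda>\<beta>. smul (of_nat (total_deg \<beta>)) (coeff f \<beta>))"

lemma coeff_euler: "coeff (euler f) \<beta> = smul (of_nat (total_deg \<beta>)) (coeff f \<beta>)"
  by (simp add: euler_def)

lemma euler_mult: "euler (f * g) = euler f * g + f * euler g"
proof (rule series_eqI)
  fix \<delta> :: "nat ^ 'r"
  have "coeff (euler (f * g)) \<delta> =
      (\<Sum>(\<alpha>, \<beta>) \<in> splits \<delta>. smul (of_nat (total_deg \<delta>)) (coeff f \<alpha> * coeff g \<beta>))"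
    by (simp add: coeff_euler coeff_mult scale_sum_right case_prod_unfold)
  also have "\<dots> = (\<Sum>(\<alpha>, \<beta>) \<in> splits \<delta>.
      coeff (euler f) \<alpha> * coeff g \<beta> + coeff f \<alpha> * coeff (euler g) \<beta>)"
    by (rule sum.cong) (auto simp: splits_def coeff_euler smul_mult_left smul_mult_right
        total_add simp flip: scale_left_distrib)
  finally show "coeff (euler (f * g)) \<delta> = coeff (euler f * g + f * euler g) \<delta>"
    by (simp add: coeff_mult sum.distrib case_prod_unfold)
qed

lemma euler_add: "euler (f + g) = euler f + euler g"
  by (rule series_eqI) (simp add: coeff_euler scale_right_distrib)

lemma euler_one [simp]: "euler 1 = 0"
  by (rule series_eqI) (simp add: coeff_euler coeff_one total_eq_0_iff)

lemma homogeneous_euler: "homogeneous f \<Longrightarrow> homogeneous (euler f)"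
  by (auto simp: homogeneous_def coeff_euler intro: subspace_scale[OF subspace_scalar_component])

text \<open>
  The Leibniz rule writes the derivative of a power as a sum of terms \<open>x ^ i * euler x * x ^ j\<close>;
  under the trace they all agree, by cyclic rotation. The factor \<open>x ^ k\<close> is there for the induction.
\<close>

lemma trace_euler_power:
  assumes "homogeneous x"
  shows "coeff (x ^ k * euler (x ^ Suc n)) \<gamma> = smul (of_nat (Suc n)) (coeff (x ^ (k + n) * euler x) \<gamma>)"
proof (induction n arbitrary: k)
  case (Suc n)
  have "coeff (x ^ k * euler (x ^ Suc (Suc n))) \<gamma> =
      coeff ((x ^ k * euler x) * x ^ Suc n) \<gamma> + coeff (x ^ Suc k * euler (x ^ Suc n)) \<gamma>"
    by (simp only: power_Suc[of x "Suc n"] euler_mult distrib_left coeff_ring_ops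
        mult.assoc power_Suc2[of x k])
  also have "coeff ((x ^ k * euler x) * x ^ Suc n) \<gamma> = coeff (x ^ Suc n * (x ^ k * euler x)) \<gamma>"
    by (intro coeff_mult_commute homogeneous_mult homogeneous_power homogeneous_euler assms)
  also have "x ^ Suc n * (x ^ k * euler x) = x ^ (k + Suc n) * euler x"
    by (simp only: mult.assoc[symmetric] power_add[symmetric] add.commute)
  also have "coeff (x ^ Suc k * euler (x ^ Suc n)) \<gamma> =
      smul (of_nat (Suc n)) (coeff (x ^ (k + Suc n) * euler x) \<gamma>)"
    using Suc[of "Suc k"] by simp
  finally show ?case
    using scale_left_distrib[of 1 "of_nat (Suc n)"] by (simp del: power_Suc)
qed simp

text \<open>
  The coefficient at \<open>\<gamma>\<close> of the logarithm of a series with constant term \<open>1\<close>; powers of exponent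
  above \<open>total_deg \<gamma>\<close> do not reach this degree.
\<close>

definition log_coeff :: "('a, 'r) series \<Rightarrow> 'a" where
  "log_coeff f = (\<Sum>n=1..total_deg \<gamma>. smul ((-1) ^ (n - 1) / of_nat n) (coeff ((f - 1) ^ n) \<gamma>))"

lemma power_uminus_mult: "coeff ((- x) ^ n * g) \<beta> = smul ((-1) ^ n) (coeff (x ^ n * g) \<beta>)"
proof (induction n arbitrary: g)
  case (Suc n)
  show ?case using Suc[of "- (x * g)"] by (simp add: power_Suc2 mult.assoc del: power_Suc)
qed simp

text \<open>
  Under the trace the familiar formula for the logarithmic derivative holds without any
  commutativity: differentiating \<open>x ^ n / n\<close> gives \<open>x ^ (n - 1) * euler x\<close>, and what remains is the
  geometric series.
\<close>

lemma log_coeff_euler: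
  assumes "homogeneous x" "coeff x 0 = 0"
  shows "smul (of_nat (total_deg \<gamma>)) (log_coeff (1 + x)) =
    coeff (geometric_inverse x * euler (1 + x)) \<gamma>"
proof -
  let ?N = "total_deg \<gamma>"
  have "smul (of_nat ?N) (log_coeff (1 + x)) =
      (\<Sum>n=1..?N. smul ((-1) ^ (n - 1) / of_nat n) (coeff (euler (x ^ n)) \<gamma>))"
    by (simp add: log_coeff_def scale_sum_right coeff_euler mult.commute)
  also have "\<dots> = (\<Sum>n=1..?N. smul ((-1) ^ (n - 1)) (coeff (x ^ (n - 1) * euler x) \<gamma>))"
  proof (rule sum.cong[OF refl])
    fix n assume "n \<in> {1..?N}"
    then obtain m where n: "n = Suc m" by (cases n) auto
    have "coeff (euler (x ^ n)) \<gamma> = smul (of_nat n) (coeff (x ^ m * euler x) \<gamma>)"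
      using trace_euler_power[OF assms(1), of 0 m] n by simp
    then show "smul ((-1) ^ (n - 1) / of_nat n) (coeff (euler (x ^ n)) \<gamma>) =
        smul ((-1) ^ (n - 1)) (coeff (x ^ (n - 1) * euler x) \<gamma>)"
      using n by (simp del: of_nat_Suc)
  qed
  also have "\<dots> = (\<Sum>n<?N. coeff ((- x) ^ n * euler x) \<gamma>)"
    by (rule sum.reindex_bij_witness[of _ Suc "\<lambda>n. n - 1"]) (auto simp: power_uminus_mult)
  also have "\<dots> = coeff ((\<Sum>n<?N. (- x) ^ n) * euler x) \<gamma>"
    by (simp add: sum_distrib_right coeff_sum)
  also have "\<dots> = coeff (geometric_inverse x * euler x) \<gamma>"
    unfolding coeff_mult
  proof (rule sum.cong[OF refl], safe)
    fix \<alpha> \<beta> assume s: "(\<alpha>, \<beta>) \<in> splits \<gamma>"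
    show "coeff (\<Sum>n<?N. (- x) ^ n) \<alpha> * coeff (euler x) \<beta> =
        coeff (geometric_inverse x) \<alpha> * coeff (euler x) \<beta>"
    \<comment> \<open>As \<open>euler x\<close> has no constant term, the inverse enters only in total degree below
      \<open>total_deg \<gamma>\<close>, where it is the truncated geometric sum.\<close>
    proof (cases "\<beta> = 0")
      case True
      then show ?thesis using assms(2) by (simp add: coeff_euler)
    next
      case False
      then have "total_deg \<beta> \<noteq> 0" using total_eq_0_iff by blast
      then have "total_deg \<alpha> < ?N"
        using s by (auto simp: splits_def total_add)
      then show ?thesis using coeff_geometric_inverse[OF assms(2)] by simp
    qed
  qed
  finally show ?thesis by (simp add: euler_add)
qed

text \<open>
  With \<open>u\<close> denoting inverses, the logarithmic derivative of \<open>f * g\<close> is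
  \<open>u g * (u f * euler f) * g + u g * euler g\<close>. The trace removes the conjugation by \<open>g\<close> in the first
  summand. This replaces the Baker-Campbell-Hausdorff formula, all of whose commutator terms the
  trace would annihilate.
\<close>

lemma log_coeff_mult:
  assumes f: "homogeneous f" "coeff f 0 = 1" and g: "homogeneous g" "coeff g 0 = 1"
  shows "log_coeff (f * g) = log_coeff f + log_coeff g"
proof -
  define u where "u h = geometric_inverse (h - 1)" for h :: "('a, 'r) series"
  have hom: "homogeneous (h - 1)" if "homogeneous h" for h
    using homogeneous_add[OF that homogeneous_minus[OF homogeneous_1]] by simp
  have inv: "u h * h = 1" "h * u h = 1" "homogeneous (u h)"
    and log: "smul (of_nat (total_deg \<gamma>)) (log_coeff h) = coeff (u h * euler h) \<gamma>"
    if "homogeneous h" "coeff h 0 = 1" for h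
    using geometric_inverse[of "h - 1"] log_coeff_euler[of "h - 1"]
      homogeneous_geometric_inverse[of "h - 1"] hom that by (auto simp: u_def coeff_one)
  have fg: "homogeneous (f * g)" "coeff (f * g) 0 = 1"
    using f g by (auto intro: homogeneous_mult)
  \<comment> \<open>Inserting \<open>f * (g * u g) * u f = 1\<close> identifies the inverse of the product.\<close>
  have "u (f * g) = u (f * g) * (f * (g * u g) * u f)"
    using inv f g by simp
  also have "\<dots> = (u (f * g) * (f * g)) * (u g * u f)" by (simp only: mult.assoc)
  finally have u: "u (f * g) = u g * u f" using inv(1)[OF fg] by simp
  have "coeff (u (f * g) * euler (f * g)) \<gamma> =
      coeff (u g * (u f * euler f * g)) \<gamma> + coeff (u g * (u f * f) * euler g) \<gamma>"
    by (simp add: u euler_mult distrib_left mult.assoc)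
  also have "coeff (u g * (u f * euler f * g)) \<gamma> = coeff (u f * euler f * g * u g) \<gamma>"
    by (intro coeff_mult_commute homogeneous_mult homogeneous_euler inv f g)
  also have "u f * euler f * g * u g = u f * euler f"
    using inv(2)[OF g] by (simp add: mult.assoc)
  also have "u g * (u f * f) * euler g = u g * euler g"
    using inv(1)[OF f] by simp
  finally have "smul (of_nat (total_deg \<gamma>)) (log_coeff (f * g)) =
      smul (of_nat (total_deg \<gamma>)) (log_coeff f + log_coeff g)"
    by (simp add: log f g fg scale_right_distrib)
  then show ?thesis
    using degree_nonzero by (simp add: total_eq_0_iff)
qed

lemma log_coeff_prod_list:
  assumes "\<And>f. f \<in> set fs \<Longrightarrow> homogeneous f \<and> coeff f 0 = 1"
  shows "log_coeff (prod_list fs) = (\<Sum>f\<leftarrow>fs. log_coeff f)"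
proof -
  have "homogeneous (prod_list fs) \<and> coeff (prod_list fs) 0 = 1 \<and>
      log_coeff (prod_list fs) = (\<Sum>f\<leftarrow>fs. log_coeff f)"
    using assms
  proof (induction fs)
    case Nil
    have "coeff (0 ^ n :: ('a, 'r) series) \<gamma> = 0" if "n \<ge> 1" for n
      using that by (cases n) auto
    then show ?case by (simp add: log_coeff_def homogeneous_1 coeff_one)
  next
    case (Cons f fs)
    then show ?case by (simp add: log_coeff_mult homogeneous_mult)
  qed
  then show ?thesis by blast
qed

end

section \<open>Change of stability\<close>

lemma slope_add_eq:
  assumes "a \<noteq> 0" "slope \<theta> a = s" "b \<noteq> 0" "slope \<theta> b = s"
  shows "slope \<theta> (a + b) = s"
proof -
  have eq: "slope \<theta> c = s \<longleftrightarrow> (\<Sum>i\<in>UNIV. \<theta> $ i * real (c $ i)) = s * real (total_deg c)"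
    if "c \<noteq> 0" for c
  proof -
    have "real (total_deg c) \<noteq> 0" using that total_eq_0_iff[of c] by simp
    then show ?thesis by (simp add: slope_def total_deg_def field_simps)
  qed
  have "a + b \<noteq> 0" using assms by (simp add: vec_add_eq_0_iff)
  then show ?thesis
    using assms eq[of a] eq[of b] eq[of "a + b"]
    by (simp add: total_add distrib_left sum.distrib)
qed

text \<open>
  The slope of a sum is a weighted mean of the slopes of its terms.
\<close>

lemma slope_sum_list:
  assumes "\<alpha>s \<noteq> []" "0 \<notin> set \<alpha>s" "\<forall>\<alpha>\<in>set \<alpha>s. slope \<theta> \<alpha> = s"
  shows "slope \<theta> (sum_list \<alpha>s) = s"
  using assms
proof (induction \<alpha>s)
  case (Cons a \<alpha>s)
  show ?case
  proof (cases "\<alpha>s = []")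
    case True
    then show ?thesis using Cons.prems by simp
  next
    case False
    then obtain b bs where \<alpha>s: "\<alpha>s = b # bs" by (cases \<alpha>s) auto
    have "sum_list \<alpha>s \<noteq> 0"
      using Cons.prems(2) by (simp add: \<alpha>s vec_add_eq_0_iff)
    then show ?thesis using slope_add_eq[of a \<theta> s "sum_list \<alpha>s"] Cons False by auto
  qed
qed simp

lemma equal_slope_decomps_eq:
  "equal_slope_decomps \<theta> \<gamma> =
    {\<alpha>s \<in> decomps \<gamma>. \<alpha>s \<noteq> [] \<and> (\<forall>\<alpha>\<in>set \<alpha>s. slope \<theta> \<alpha> = slope \<theta> \<gamma>)}"
proof -
  have "\<forall>\<alpha>\<in>set \<alpha>s. slope \<theta> \<alpha> = slope \<theta> (sum_list \<alpha>s)"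
    if "\<alpha>s \<noteq> []" "0 \<notin> set \<alpha>s" "sorted_wrt (\<lambda>a b. slope \<theta> a = slope \<theta> b) \<alpha>s" for \<alpha>s
  proof -
    have "\<forall>\<alpha>\<in>set \<alpha>s. slope \<theta> \<alpha> = slope \<theta> (hd \<alpha>s)"
      using that by (cases \<alpha>s) auto
    with slope_sum_list[OF that(1,2) this] show ?thesis by simp
  qed
  moreover have "sorted_wrt (\<lambda>a b. slope \<theta> a = slope \<theta> b) \<alpha>s"
    if "\<forall>\<alpha>\<in>set \<alpha>s. slope \<theta> \<alpha> = s" for \<alpha>s s
    using that by (induction \<alpha>s) auto
  ultimately show ?thesis
    unfolding equal_slope_decomps_def decomps_def by blast
qed

text \<open>
  The recursion for degree \<open>\<gamma>\<close> only involves degrees of smaller or equal total degree. This permits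
  truncation, which is necessary because a parameter \<open>\<theta>'\<close> close to \<open>\<theta>\<close> refines the order of slopes
  only in bounded degree.
\<close>

lemma stable_inv_cong:
  assumes "\<And>\<beta>. \<beta> \<noteq> 0 \<Longrightarrow> total_deg \<beta> \<le> N \<Longrightarrow> A \<beta> = B \<beta>" "\<gamma> \<noteq> 0" "total_deg \<gamma> \<le> N"
  shows "stable_inv A \<theta> \<gamma> = stable_inv B \<theta> \<gamma>"
  using assms(2,3)
proof (induction "total_deg \<gamma>" arbitrary: \<gamma> rule: less_induct)
  case less
  have "map (stable_inv A \<theta>) \<alpha>s = map (stable_inv B \<theta>) \<alpha>s"
    if "\<alpha>s \<in> {\<alpha>s \<in> decreasing_decomps \<theta> \<gamma>. length \<alpha>s \<noteq> 1}" for \<alpha>s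
  proof (rule map_cong[OF refl])
    fix \<alpha> assume "\<alpha> \<in> set \<alpha>s"
    with that have "total_deg \<alpha> < total_deg \<gamma>" "\<alpha> \<noteq> 0"
      using total_less_of_decomp[of \<alpha>s \<alpha>] by (auto simp: decreasing_decomps_def)
    with less show "stable_inv A \<theta> \<alpha> = stable_inv B \<theta> \<alpha>" by simp
  qed
  then have "(\<Sum>\<alpha>s \<in> {\<alpha>s \<in> decreasing_decomps \<theta> \<gamma>. length \<alpha>s \<noteq> 1}.
        prod_list (map (stable_inv A \<theta>) \<alpha>s)) =
      (\<Sum>\<alpha>s \<in> {\<alpha>s \<in> decreasing_decomps \<theta> \<gamma>. length \<alpha>s \<noteq> 1}.
        prod_list (map (stable_inv B \<theta>) \<alpha>s))"
    by (intro sum.cong refl arg_cong[of _ _ prod_list])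
  then show ?case
    using assms(1)[OF less.prems] stable_inv.simps[of A \<theta> \<gamma>] stable_inv.simps[of B \<theta> \<gamma>] by simp
qed

lemma log_inv_eq:
  assumes "\<And>\<beta>. \<beta> \<noteq> 0 \<Longrightarrow> total_deg \<beta> \<le> total_deg \<gamma> \<Longrightarrow> stable_inv A \<theta> \<beta> = G \<beta>"
  shows "log_inv smul A \<theta> \<gamma> =
    (\<Sum>\<alpha>s \<in> equal_slope_decomps \<theta> \<gamma>.
      smul ((-1) ^ (length \<alpha>s - 1) / of_nat (length \<alpha>s)) (prod_list (map G \<alpha>s)))"
  unfolding log_inv_def
proof (rule sum.cong[OF refl])
  fix \<alpha>s assume \<alpha>s: "\<alpha>s \<in> equal_slope_decomps \<theta> \<gamma>"
  have "map (stable_inv A \<theta>) \<alpha>s = map G \<alpha>s"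
  proof (rule map_cong[OF refl])
    fix \<alpha> assume "\<alpha> \<in> set \<alpha>s"
    then have "\<alpha> \<noteq> 0" "total_deg \<alpha> \<le> total_deg \<gamma>"
      using \<alpha>s total_le_sum_list[of \<alpha> \<alpha>s] by (auto simp: equal_slope_decomps_def)
    then show "stable_inv A \<theta> \<alpha> = G \<alpha>" by (rule assms)
  qed
  then show "smul ((-1) ^ (length \<alpha>s - 1) / of_nat (length \<alpha>s)) (prod_list (map (stable_inv A \<theta>) \<alpha>s)) =
      smul ((-1) ^ (length \<alpha>s - 1) / of_nat (length \<alpha>s)) (prod_list (map G \<alpha>s))"
    by (simp only:)
qed

lemma (in graded_rat_algebra) prod_list_component:
  assumes "\<alpha>s \<noteq> []" "\<And>\<alpha>. \<alpha> \<in> set \<alpha>s \<Longrightarrow> F \<alpha> \<in> R \<alpha>"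
  shows "prod_list (map F \<alpha>s) \<in> R (sum_list \<alpha>s)"
  using assms
proof (induction \<alpha>s)
  case (Cons a \<alpha>s)
  then show ?case by (cases "\<alpha>s = []") (auto intro: mult_component)
qed simp

lemma (in graded_rat_algebra) stable_inv_component:
  assumes "\<And>\<beta>. \<beta> \<noteq> 0 \<Longrightarrow> A \<beta> \<in> R \<beta>" "\<beta> \<noteq> 0"
  shows "stable_inv A \<theta> \<beta> \<in> R \<beta>"
  using assms(2)
proof (induction "total_deg \<beta>" arbitrary: \<beta> rule: less_induct)
  case less
  have "prod_list (map (stable_inv A \<theta>) \<alpha>s) \<in> R \<beta>"
    if "\<alpha>s \<in> {\<alpha>s \<in> decreasing_decomps \<theta> \<beta>. length \<alpha>s \<noteq> 1}" for \<alpha>s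
  proof -
    have \<alpha>s: "\<alpha>s \<noteq> []" "0 \<notin> set \<alpha>s" "length \<alpha>s \<noteq> 1" "sum_list \<alpha>s = \<beta>"
      using that by (auto simp: decreasing_decomps_def)
    have "stable_inv A \<theta> \<alpha> \<in> R \<alpha>" if "\<alpha> \<in> set \<alpha>s" for \<alpha>
      by (rule less.hyps) (use total_less_of_decomp[of \<alpha>s \<alpha>] \<alpha>s that in auto)
    then show ?thesis using prod_list_component[of \<alpha>s "stable_inv A \<theta>"] \<alpha>s by simp
  qed
  then have "A \<beta> - (\<Sum>\<alpha>s \<in> {\<alpha>s \<in> decreasing_decomps \<theta> \<beta>. length \<alpha>s \<noteq> 1}.
      prod_list (map (stable_inv A \<theta>) \<alpha>s)) \<in> R \<beta>"
    by (intro subspace_diff[OF subspace_component] subspace_sum[OF subspace_component]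
        assms(1) less.prems)
  then show ?case by (simp add: stable_inv.simps[of A \<theta> \<beta>])
qed

context commuting_degree
begin

text \<open>
  Grouping the decompositions in \<open>log_inv\<close> by their length \<open>n\<close> gives the \<open>n\<close>-th powers in the
  logarithm. Entries that all have slope \<open>t\<close> cannot add up to a degree of any other slope, so a
  factor of another slope does not contribute.
\<close>

lemma log_coeff_part:
  "log_coeff (1 + part (slope \<theta>) G t) =
    (if t = slope \<theta> \<gamma> then \<Sum>\<alpha>s \<in> equal_slope_decomps \<theta> \<gamma>.
        smul ((-1) ^ (length \<alpha>s - 1) / of_nat (length \<alpha>s)) (prod_list (map G \<alpha>s))
     else 0)"
proof -
  let ?c = "\<lambda>\<alpha>s. smul ((-1) ^ (length \<alpha>s - 1) / of_nat (length \<alpha>s)) (prod_list (map G \<alpha>s))"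
  let ?D = "{\<alpha>s \<in> decomps \<gamma>. \<alpha>s \<noteq> [] \<and> (\<forall>\<alpha>\<in>set \<alpha>s. slope \<theta> \<alpha> = t)}"
  have "log_coeff (1 + part (slope \<theta>) G t) =
      (\<Sum>n=1..total_deg \<gamma>. \<Sum>\<alpha>s \<in> {\<alpha>s \<in> ?D. length \<alpha>s = n}. ?c \<alpha>s)"
    unfolding log_coeff_def
  proof (rule sum.cong[OF refl])
    fix n assume n: "n \<in> {1..total_deg \<gamma>}"
    have eq: "{\<alpha>s \<in> decomps \<gamma>. length \<alpha>s = n \<and> (\<forall>\<alpha>\<in>set \<alpha>s. slope \<theta> \<alpha> = t)} =
        {\<alpha>s \<in> ?D. length \<alpha>s = n}"
      using n by auto
    show "smul ((-1) ^ (n - 1) / of_nat n) (coeff ((1 + part (slope \<theta>) G t - 1) ^ n) \<gamma>) =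
        (\<Sum>\<alpha>s \<in> {\<alpha>s \<in> ?D. length \<alpha>s = n}. ?c \<alpha>s)"
      by (simp only: add_diff_cancel_left' coeff_part_power eq scale_sum_right) (rule sum.cong; simp)
  qed
  also have "\<dots> = sum ?c ?D"
  proof (rule sum.group)
    show "length ` ?D \<subseteq> {1..total_deg \<gamma>}"
      using length_le_total by (auto simp: decomps_def Suc_le_eq)
  qed auto
  also have "\<dots> = (if t = slope \<theta> \<gamma> then sum ?c (equal_slope_decomps \<theta> \<gamma>) else 0)"
  proof (cases "t = slope \<theta> \<gamma>")
    case False
    then have "?D = {}" using slope_sum_list[of _ \<theta> t] by (auto simp: decomps_def)
    with False show ?thesis by (simp only: sum.empty if_False)
  qed (simp add: equal_slope_decomps_eq)
  finally show ?thesis .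
qed

end

definition decreasing_list :: "real set \<Rightarrow> real list" where
  "decreasing_list X = rev (sorted_list_of_set X)"

lemma decreasing_list:
  assumes "finite X"
  shows "set (decreasing_list X) = X" "sorted_wrt (>) (decreasing_list X)"
    "distinct (decreasing_list X)"
  using assms by (auto simp: decreasing_list_def sorted_wrt_rev)

lemma sorted_wrt_concat_map:
  assumes "sorted_wrt P xs" "\<And>x. x \<in> set xs \<Longrightarrow> sorted_wrt Q (f x)"
    and "\<And>x y a b. P x y \<Longrightarrow> x \<in> set xs \<Longrightarrow> y \<in> set xs \<Longrightarrow> a \<in> set (f x) \<Longrightarrow> b \<in> set (f y) \<Longrightarrow> Q a b"
  shows "sorted_wrt Q (concat (map f xs))"
  using assms by (induction xs) (fastforce simp: sorted_wrt_append)+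

lemma prod_list_concat: "prod_list (concat xss) = prod_list (map prod_list xss)"
  by (induction xss) auto

text \<open>
  The order by \<open>\<theta>'\<close>-slope refines the order by \<open>\<theta>\<close>-slope on the finite set \<open>U\<close> of degrees, and
  \<open>G\<close> plays the role of the invariants for \<open>\<theta>'\<close>, cut off outside \<open>U\<close>. Within \<open>U\<close>, a
  \<open>\<theta>'\<close>-slope determines the \<open>\<theta>\<close>-slope, and the \<open>\<theta>'\<close>-slopes belonging to one \<open>\<theta>\<close>-slope form
  a block in the order of all \<open>\<theta>'\<close>-slopes.
\<close>

locale stability_perturbation =
  fixes \<theta> \<theta>' :: "real ^ 'r::finite" and U :: "(nat ^ 'r) set"
    and G :: "nat ^ 'r \<Rightarrow> 'a::{ring, monoid_mult}"
  assumes finite_U: "finite U"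
    and slope_less: "\<And>a b. a \<in> U \<Longrightarrow> b \<in> U \<Longrightarrow> slope \<theta> b < slope \<theta> a \<Longrightarrow> slope \<theta>' b < slope \<theta>' a"
    and support: "\<And>\<alpha>. \<alpha> \<notin> U \<Longrightarrow> G \<alpha> = 0"
begin

definition slopes :: "real \<Rightarrow> real list" where
  "slopes s = decreasing_list (slope \<theta>' ` {\<alpha> \<in> U. slope \<theta> \<alpha> = s})"

definition slope_class :: "real \<Rightarrow> ('a, 'r) series" where
  "slope_class s = (\<Prod>t\<leftarrow>slopes s. 1 + part (slope \<theta>') G t)"

text \<open>
  The invariants for \<open>\<theta>\<close> in terms of those for \<open>\<theta>'\<close>, read off from the block of factors of the
  given \<open>\<theta>\<close>-slope.
\<close>

definition coarse :: "nat ^ 'r \<Rightarrow> 'a" where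
  "coarse \<alpha> = coeff (slope_class (slope \<theta> \<alpha>)) \<alpha>"

lemma slopes: "set (slopes s) = slope \<theta>' ` {\<alpha> \<in> U. slope \<theta> \<alpha> = s}"
    "sorted_wrt (>) (slopes s)" "distinct (slopes s)"
  using finite_U by (simp_all add: slopes_def decreasing_list)

lemma slope_eq: "a \<in> U \<Longrightarrow> b \<in> U \<Longrightarrow> slope \<theta>' a = slope \<theta>' b \<Longrightarrow> slope \<theta> a = slope \<theta> b"
  by (metis less_irrefl linorder_neqE slope_less)

text \<open>
  A block of factors has no terms outside its \<open>\<theta>\<close>-slope: a nonzero term of the expanded product
  comes from entries in \<open>U\<close> that all have \<open>\<theta>\<close>-slope \<open>s\<close>, hence so does their sum.
\<close>

lemma slope_class_eq: "slope_class s = 1 + part (slope \<theta>) coarse s"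
proof (rule series_eqI)
  fix \<beta> :: "nat ^ 'r"
  let ?D = "{\<alpha>s \<in> decomps \<beta>. sorted_wrt (\<lambda>a b. slope \<theta>' a > slope \<theta>' b) \<alpha>s \<and>
      slope \<theta>' ` set \<alpha>s \<subseteq> set (slopes s)}"
  have c: "coeff (slope_class s) \<beta> = (\<Sum>\<alpha>s \<in> ?D. prod_list (map G \<alpha>s))"
    unfolding slope_class_def by (rule coeff_ordered_prod[OF slopes(2)])
  consider "\<beta> = 0" | "\<beta> \<noteq> 0" "slope \<theta> \<beta> = s" | "\<beta> \<noteq> 0" "slope \<theta> \<beta> \<noteq> s" by blast
  then show "coeff (slope_class s) \<beta> = coeff (1 + part (slope \<theta>) coarse s) \<beta>"
  proof cases
    case 1
    have "\<alpha>s = []" if "\<alpha>s \<in> decomps 0" for \<alpha>s :: "(nat ^ 'r) list"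
      using that by (cases \<alpha>s) (auto simp: decomps_def vec_add_eq_0_iff)
    moreover have "[] \<in> decomps (0 :: nat ^ 'r)" by (simp add: decomps_def)
    ultimately have "?D = {[]}" unfolding 1 by (intro equalityI subsetI) simp_all
    then show ?thesis using 1 c by (simp add: coeff_part coeff_one)
  next
    case 2
    then show ?thesis by (simp add: coeff_part coeff_one coarse_def)
  next
    case 3
    have "prod_list (map G \<alpha>s) = 0" if \<alpha>s: "\<alpha>s \<in> ?D" for \<alpha>s
    proof (rule ccontr)
      assume "prod_list (map G \<alpha>s) \<noteq> 0"
      then have U: "\<alpha> \<in> U" if "\<alpha> \<in> set \<alpha>s" for \<alpha>
        using that support prod_list_eq_0[of \<alpha> \<alpha>s G] by metis
      have "\<forall>\<alpha>\<in>set \<alpha>s. slope \<theta> \<alpha> = s"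
      proof
        fix \<alpha> assume \<alpha>: "\<alpha> \<in> set \<alpha>s"
        then have "slope \<theta>' \<alpha> \<in> slope \<theta>' ` {\<alpha> \<in> U. slope \<theta> \<alpha> = s}"
          using \<alpha>s slopes(1) by blast
        then obtain b where "b \<in> U" "slope \<theta> b = s" "slope \<theta>' \<alpha> = slope \<theta>' b" by blast
        with slope_eq[OF U[OF \<alpha>]] show "slope \<theta> \<alpha> = s" by simp
      qed
      moreover have "\<alpha>s \<noteq> []" using \<alpha>s 3 by (auto simp: decomps_def)
      ultimately show False using slope_sum_list[of \<alpha>s \<theta> s] \<alpha>s 3 by (auto simp: decomps_def)
    qed
    then show ?thesis using 3 c by (simp add: coeff_part coeff_one)
  qed
qed

text \<open>
  Concatenating the blocks in decreasing order of \<open>\<theta>\<close>-slope yields the list of all \<open>\<theta>'\<close>-slopes in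
  decreasing order. Thus both sides are coefficients of one and the same product, bracketed in two
  ways.
\<close>

lemma sum_coarse:
  assumes "\<beta> \<noteq> 0"
  shows "(\<Sum>\<alpha>s \<in> decreasing_decomps \<theta> \<beta>. prod_list (map coarse \<alpha>s)) =
    (\<Sum>\<alpha>s \<in> decreasing_decomps \<theta>' \<beta>. prod_list (map G \<alpha>s))"
proof -
  define ss where "ss = decreasing_list (slope \<theta> ` U)"
  have ss: "set ss = slope \<theta> ` U" "sorted_wrt (>) ss"
    using finite_U by (simp_all add: ss_def decreasing_list)
  have sorted_slopes: "sorted_wrt (>) (concat (map slopes ss))"
  proof (rule sorted_wrt_concat_map[OF ss(2) slopes(2)])
    fix s t a b assume "s > t" "a \<in> set (slopes s)" "b \<in> set (slopes t)"
    then show "a > b" unfolding slopes(1) using slope_less by blast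
  qed
  have set_slopes: "set (concat (map slopes ss)) = slope \<theta>' ` U"
    by (auto simp: slopes(1) ss(1))
  have coarse_0: "coarse \<alpha> = 0" if "\<alpha> \<noteq> 0" "slope \<theta> \<alpha> \<notin> set ss" for \<alpha>
  proof -
    have "slope \<theta> a \<noteq> slope \<theta> \<alpha>" if "a \<in> U" for a
      using imageI[OF that, of "slope \<theta>"] \<open>slope \<theta> \<alpha> \<notin> set ss\<close> unfolding ss(1) by metis
    then have "set (slopes (slope \<theta> \<alpha>)) = {}" by (simp add: slopes(1))
    then have "slopes (slope \<theta> \<alpha>) = []" by simp
    then have "coarse \<alpha> = coeff 1 \<alpha>" by (simp only: coarse_def slope_class_def list.map prod_list.Nil)
    then show ?thesis using that(1) by (simp add: coeff_one)
  qed
  have "(\<Sum>\<alpha>s \<in> decreasing_decomps \<theta> \<beta>. prod_list (map coarse \<alpha>s)) =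
      coeff (\<Prod>s\<leftarrow>ss. 1 + part (slope \<theta>) coarse s) \<beta>"
    by (rule coeff_ordered_prod_slope[OF ss(2) assms coarse_0, symmetric])
  also have "(\<Prod>s\<leftarrow>ss. 1 + part (slope \<theta>) coarse s) =
      (\<Prod>t\<leftarrow>concat (map slopes ss). 1 + part (slope \<theta>') G t)"
    by (simp add: map_concat prod_list_concat comp_def slope_class_def[symmetric] slope_class_eq)
  also have "coeff \<dots> \<beta> = (\<Sum>\<alpha>s \<in> decreasing_decomps \<theta>' \<beta>. prod_list (map G \<alpha>s))"
  proof (rule coeff_ordered_prod_slope[OF sorted_slopes assms])
    fix \<alpha> assume "slope \<theta>' \<alpha> \<notin> set (concat (map slopes ss))"
    then show "G \<alpha> = 0" unfolding set_slopes using support by blast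
  qed
  finally show ?thesis .
qed

end

text \<open>
  The block of \<open>\<theta>\<close>-slope \<open>slope \<theta> \<gamma>\<close> factors over the \<open>\<theta>'\<close>-slopes it contains. All degrees in it
  lie in \<open>C\<close>, so the logarithm at \<open>\<gamma>\<close> is additive on this product, and only the factor of slope
  \<open>slope \<theta>' \<gamma>\<close> contributes.
\<close>

lemma (in commuting_degree) log_inv_perturbation:
  assumes "\<And>\<alpha>. \<alpha> \<noteq> 0 \<Longrightarrow> A \<alpha> \<in> R \<alpha>"
    and less: "\<And>a b. a \<noteq> 0 \<Longrightarrow> b \<noteq> 0 \<Longrightarrow> total_deg a \<le> total_deg \<gamma> \<Longrightarrow> total_deg b \<le> total_deg \<gamma> \<Longrightarrow>
      slope \<theta> b < slope \<theta> a \<Longrightarrow> slope \<theta>' b < slope \<theta>' a"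
    and C: "\<And>\<alpha>. \<alpha> \<noteq> 0 \<Longrightarrow> slope \<theta> \<alpha> = slope \<theta> \<gamma> \<Longrightarrow> \<alpha> \<in> C"
  shows "log_inv smul A \<theta>' \<gamma> = log_inv smul A \<theta> \<gamma>"
proof -
  define U where "U = {\<alpha> :: nat ^ 'r. \<alpha> \<noteq> 0 \<and> total_deg \<alpha> \<le> total_deg \<gamma>}"
  define G where "G \<alpha> = (if \<alpha> \<in> U then stable_inv A \<theta>' \<alpha> else 0)" for \<alpha>
  \<comment> \<open>\<open>B\<close> agrees with \<open>A\<close> up to the total degree of \<open>\<gamma>\<close>, but its invariants for \<open>\<theta>\<close> are \<open>coarse\<close> in
    every degree, so that uniqueness of the recursion applies.\<close>
  define B where "B \<beta> = (\<Sum>\<alpha>s \<in> decreasing_decomps \<theta>' \<beta>. prod_list (map G \<alpha>s))" for \<beta>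
  interpret stability_perturbation \<theta> \<theta>' U G
  proof
    show "finite U" by (rule finite_subset[OF _ finite_total_le[of "total_deg \<gamma>"]]) (auto simp: U_def)
  qed (auto simp: U_def G_def intro: less)
  have AB: "A \<beta> = B \<beta>" if "\<beta> \<noteq> 0" "total_deg \<beta> \<le> total_deg \<gamma>" for \<beta>
    unfolding B_def stable_inv_recursion[OF that(1), of A \<theta>']
  proof (rule sum.cong[OF refl])
    fix \<alpha>s assume "\<alpha>s \<in> decreasing_decomps \<theta>' \<beta>"
    then have "\<forall>\<alpha>\<in>set \<alpha>s. \<alpha> \<in> U"
      using that total_le_sum_list[of _ \<alpha>s] by (force simp: decreasing_decomps_def U_def)
    then have "map (stable_inv A \<theta>') \<alpha>s = map G \<alpha>s" by (simp add: G_def)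
    then show "prod_list (map (stable_inv A \<theta>') \<alpha>s) = prod_list (map G \<alpha>s)" by (simp only:)
  qed
  have G: "stable_inv A \<theta>' \<beta> = G \<beta>" if "\<beta> \<noteq> 0" "total_deg \<beta> \<le> total_deg \<gamma>" for \<beta>
    using that by (simp add: G_def U_def)
  have coarse: "stable_inv A \<theta> \<beta> = coarse \<beta>" if "\<beta> \<noteq> 0" "total_deg \<beta> \<le> total_deg \<gamma>" for \<beta>
  proof -
    have "stable_inv A \<theta> \<beta> = stable_inv B \<theta> \<beta>"
      by (rule stable_inv_cong[OF AB that])
    also have "\<dots> = coarse \<beta>"
      using that(1) by (intro stable_inv_unique[symmetric]) (simp_all add: B_def sum_coarse)
    finally show ?thesis .
  qed
  have "\<gamma> \<in> U" using degree_nonzero by (simp add: U_def)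
  let ?s = "slope \<theta> \<gamma>" and ?t = "slope \<theta>' \<gamma>"
  have hom: "homogeneous (1 + part (slope \<theta>') G t)" if t: "t \<in> set (slopes ?s)" for t
  proof -
    have "coeff (part (slope \<theta>') G t) \<beta> \<in> scalar_component \<beta>" for \<beta>
    proof (cases "\<beta> \<in> U \<and> slope \<theta>' \<beta> = t")
      case True
      obtain b where "b \<in> U" "slope \<theta> b = ?s" "slope \<theta>' b = t"
        using t unfolding slopes(1) by blast
      then have "slope \<theta> \<beta> = ?s"
        using slope_eq[of \<beta> b] True by simp
      then have "\<beta> \<noteq> 0" "\<beta> \<in> C" using True C by (auto simp: U_def)
      then show ?thesis
        using True stable_inv_component[OF assms(1), where \<beta> = \<beta> and \<theta> = \<theta>']
        by (simp add: coeff_part scalar_component_def G_def)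
    next
      case False
      then show ?thesis
        by (auto simp: coeff_part G_def subspace_0[OF subspace_scalar_component])
    qed
    then show ?thesis
      by (intro homogeneous_add homogeneous_1) (simp add: homogeneous_def)
  qed
  have "log_inv smul A \<theta> \<gamma> = log_coeff (1 + part (slope \<theta>) coarse ?s)"
    by (simp add: log_coeff_part log_inv_eq[OF coarse])
  also have "\<dots> = log_coeff (slope_class ?s)"
    by (simp only: slope_class_eq)
  also have "\<dots> = (\<Sum>t\<leftarrow>slopes ?s. log_coeff (1 + part (slope \<theta>') G t))"
    unfolding slope_class_def
  proof (subst log_coeff_prod_list)
    fix f assume "f \<in> set (map (\<lambda>t. 1 + part (slope \<theta>') G t) (slopes ?s))"
    then obtain t where "t \<in> set (slopes ?s)" "f = 1 + part (slope \<theta>') G t" by auto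
    then show "homogeneous f \<and> coeff f 0 = 1"
      using hom by (simp add: coeff_part coeff_one)
  qed (simp add: comp_def)
  also have "\<dots> = (\<Sum>t \<in> set (slopes ?s). log_coeff (1 + part (slope \<theta>') G t))"
    by (rule sum_list_distinct_conv_sum_set[OF slopes(3)])
  also have "\<dots> = (\<Sum>t \<in> {?t}. log_coeff (1 + part (slope \<theta>') G t))"
  proof (rule sum.mono_neutral_right)
    show "{?t} \<subseteq> set (slopes ?s)"
      using \<open>\<gamma> \<in> U\<close> by (auto simp: slopes(1))
  qed (auto simp: log_coeff_part)
  also have "\<dots> = log_inv smul A \<theta>' \<gamma>"
    by (simp add: log_coeff_part log_inv_eq[OF G])
  finally show ?thesis by simp
qed

lemma slope_order_stable:
  fixes \<theta> :: "real ^ 'r::finite"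
  shows "\<exists>\<epsilon>>0. \<forall>\<theta>'. dist \<theta>' \<theta> < \<epsilon> \<longrightarrow> (\<forall>a b. total_deg a \<le> N \<longrightarrow> total_deg b \<le> N \<longrightarrow>
    slope \<theta> b < slope \<theta> a \<longrightarrow> slope \<theta>' b < slope \<theta>' a)"
proof -
  define P where "P = {(a, b) \<in> {a. total_deg a \<le> N} \<times> {b. total_deg b \<le> N}. slope \<theta> b < slope \<theta> a}"
  have "finite P"
    by (rule finite_subset[of _ "{a. total_deg a \<le> N} \<times> {b. total_deg b \<le> N}"])
      (auto simp: P_def finite_total_le)
  moreover have "open {t. slope t b < slope t a}" for a b :: "nat ^ 'r"
    unfolding slope_def divide_inverse by (intro open_Collect_less continuous_intros)
  ultimately have "open (\<Inter>(a, b) \<in> P. {t. slope t b < slope t a})"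
    by (intro open_INT) auto
  moreover have "\<theta> \<in> (\<Inter>(a, b) \<in> P. {t. slope t b < slope t a})"
    by (auto simp: P_def)
  ultimately obtain \<epsilon> where "\<epsilon> > 0" "\<And>t. dist t \<theta> < \<epsilon> \<Longrightarrow> t \<in> (\<Inter>(a, b) \<in> P. {t. slope t b < slope t a})"
    unfolding open_dist by blast
  then show ?thesis by (intro exI[of _ \<epsilon>]) (auto simp: P_def)
qed

lemma slope_attractor_stability:
  assumes "skew_bilinear form" "\<alpha> \<noteq> 0"
  shows "slope (attractor_stability form \<gamma>) \<alpha> = 0 \<longleftrightarrow> form (int_vec \<alpha>) (int_vec \<gamma>) = 0"
proof -
  have "(\<Sum>i\<in>UNIV. real (\<alpha> $ i)) \<noteq> 0"
    using assms(2) total_eq_0_iff[of \<alpha>] by (simp add: total_deg_def flip: of_nat_sum)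
  then show ?thesis
    by (simp add: slope_def attractor_stability_pairing[OF assms(1)])
qed

lemma int_vec_add: "int_vec (\<alpha> + \<beta>) = int_vec \<alpha> + int_vec \<beta>"
  by (simp add: int_vec_def vec_eq_iff)

theorem theorem3p4:
  fixes smul :: "rat \<Rightarrow> 'a::{ring, monoid_mult} \<Rightarrow> 'a"
    and R :: "nat ^ 'r::finite \<Rightarrow> 'a set"
    and form :: "int ^ 'r \<Rightarrow> int ^ 'r \<Rightarrow> int"
    and A :: "nat ^ 'r \<Rightarrow> 'a"
    and \<gamma> :: "nat ^ 'r"
  assumes "graded_rat_algebra smul R"
    and "skew_bilinear form"
    and "\<forall>\<alpha> \<beta>. form (int_vec \<alpha>) (int_vec \<beta>) = 0 \<longrightarrow> (\<forall>x \<in> R \<alpha>. \<forall>y \<in> R \<beta>. x * y = y * x)"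
    and "\<forall>\<alpha>. \<alpha> \<noteq> 0 \<longrightarrow> A \<alpha> \<in> R \<alpha>"
    and "\<gamma> \<noteq> 0"
  shows "attractor_inv smul form A \<gamma> = log_inv smul A (attractor_stability form \<gamma>) \<gamma>"
proof -
  interpret graded_rat_algebra smul R by fact
  let ?\<theta> = "attractor_stability form \<gamma>"
  have add_left: "form (x + y) z = form x z + form y z"
    and add_right: "form x (y + z) = form x y + form x z"
    and skew: "form x y = - form y x" for x y z
    using assms(2) unfolding skew_bilinear_def by blast+
  have self: "form x x = 0" for x using skew[of x x] by simp
  interpret commuting_degree smul R "{\<alpha>. form (int_vec \<alpha>) (int_vec \<gamma>) = 0}" \<gamma>
  proof
    fix \<alpha> \<beta> x y
    assume \<alpha>: "\<alpha> \<in> {\<alpha>. form (int_vec \<alpha>) (int_vec \<gamma>) = 0}" and "\<alpha> + \<beta> = \<gamma>" "x \<in> R \<alpha>" "y \<in> R \<beta>"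
    then have "form (int_vec \<alpha>) (int_vec \<beta>) = 0"
      using self by (auto simp: int_vec_add add_right)
    then show "x * y = y * x" using assms(3) \<open>x \<in> R \<alpha>\<close> \<open>y \<in> R \<beta>\<close> by blast
  qed (use \<open>\<gamma> \<noteq> 0\<close> in \<open>auto simp: int_vec_add add_left\<close>)
  obtain \<epsilon> where \<epsilon>: "\<epsilon> > 0" and close: "\<And>\<theta>' a b. dist \<theta>' ?\<theta> < \<epsilon> \<Longrightarrow>
      total_deg a \<le> total_deg \<gamma> \<Longrightarrow> total_deg b \<le> total_deg \<gamma> \<Longrightarrow>
      slope ?\<theta> b < slope ?\<theta> a \<Longrightarrow> slope \<theta>' b < slope \<theta>' a"
    using slope_order_stable[of ?\<theta> "total_deg \<gamma>"] by blast
  have slope_\<gamma>: "slope ?\<theta> \<gamma> = 0"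
    using slope_attractor_stability[OF assms(2,5)] self by simp
  have eq: "log_inv smul A \<theta>' \<gamma> = log_inv smul A ?\<theta> \<gamma>" if "dist \<theta>' ?\<theta> < \<epsilon>" for \<theta>'
    using assms(4) close[OF that] slope_attractor_stability[OF assms(2)] slope_\<gamma>
    by (intro log_inv_perturbation) auto
  show ?thesis
    unfolding attractor_inv_def
  proof (rule the_equality)
    show "\<exists>\<epsilon>>0. \<forall>\<theta>'. generic \<theta>' \<and> dist \<theta>' ?\<theta> < \<epsilon> \<longrightarrow> log_inv smul A \<theta>' \<gamma> = log_inv smul A ?\<theta> \<gamma>"
      using \<epsilon> eq by blast
  next
    fix x assume "\<exists>\<delta>>0. \<forall>\<theta>'. generic \<theta>' \<and> dist \<theta>' ?\<theta> < \<delta> \<longrightarrow> log_inv smul A \<theta>' \<gamma> = x"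
    then obtain \<delta> where \<delta>: "\<delta> > 0"
        "\<And>\<theta>'. generic \<theta>' \<Longrightarrow> dist \<theta>' ?\<theta> < \<delta> \<Longrightarrow> log_inv smul A \<theta>' \<gamma> = x" by blast
    obtain \<theta>' where "generic \<theta>'" "dist \<theta>' ?\<theta> < \<epsilon>" "dist \<theta>' ?\<theta> < \<delta>"
      using generic_dense[of "min \<epsilon> \<delta>" ?\<theta>] \<epsilon> \<delta>(1) by auto
    then show "x = log_inv smul A ?\<theta> \<gamma>" using \<delta>(2) eq by metis
  qed
qed

end
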